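(* Let $A,B\subset\omega_1$ have the subspace topology inherited from the order topology on $\omega_1$, and give $A\times B$ the product topology. Then the following conditions are equivalent: (a) $A\times B$ is collectionwise normal; (b) $A\times B$ is normal; (c) either one of $A$ or $B$ is not stationary, or $A\cap B$ is stationary; (d) $A\times B$ is semi-proximal.
   Context: Stationary means stationary in $\omega_1$. Entourages of a uniformity are taken to be symmetric, and $U[x]=\{y:\langle x,y\rangle\in U\}$. A uniformity on a space is compatible if it induces the given topology. Proximal game on a uniform space $\langle X,\mathfrak{U}\rangle$: in inning $0$, player 1 chooses an entourage $U_0$ and then player 2 chooses $x_0\in X$. In inning $n+1$, player 1 chooses an entourage $U_{n+1}\subset U_n$ and then player 2 chooses $x_{n+1}\in U_n[x_n]$. Player 1 wins if either $\bigcap\{U_n[x_n]:n<\omega\}=\emptyset$ or the sequence $\{x_n:n<\omega\}$ converges in $X$; otherwise player 2 wins. Players know all previous moves. A uniform space is semi-proximal if player 2 does not have a winning strategy in the proximal game. A topological space is called semi-proximal if it is semi-proximal with respect to some compatible uniformity. *)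

theory Defs
  imports "HOL-Analysis.Analysis"
begin

text \<open>The first uncountable ordinal, as the well-order \<^term>\<open>cardSuc natLeq\<close> turned into a
  type. The lemmas \<open>uncountable_omega1\<close> and \<open>countable_lessThan_omega1\<close> below
  determine it up to order isomorphism.\<close>

lemma Field_cardSuc_natLeq_infinite: "infinite (Field (cardSuc natLeq))"
  using cardSuc_finite[OF natLeq_Card_order] infinite_UNIV_nat unfolding Field_natLeq by blast

typedef omega1 = "Field (cardSuc natLeq)"
  using Field_cardSuc_natLeq_infinite by (metis ex_in_conv finite.emptyI)

lemma cardSuc_natLeq_Well_order: "Well_order (cardSuc natLeq)"
  using cardSuc_Card_order[OF natLeq_Card_order] by (simp add: card_order_on_def)

instantiation omega1 :: wellorder
begin

definition less_eq_omega1 :: "omega1 \<Rightarrow> omega1 \<Rightarrow> bool" where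
  "x \<le> y \<longleftrightarrow> (Rep_omega1 x, Rep_omega1 y) \<in> cardSuc natLeq"

definition less_omega1 :: "omega1 \<Rightarrow> omega1 \<Rightarrow> bool" where
  "x < y \<longleftrightarrow> x \<le> y \<and> x \<noteq> (y::omega1)"

instance
proof -
  let ?r = "cardSuc natLeq"
  note wo = cardSuc_natLeq_Well_order
  have refl: "(a, a) \<in> ?r" if "a \<in> Field ?r" for a
    using wo that by (auto simp: order_on_defs refl_on_def)
  have trans: "trans ?r" and antisym: "antisym ?r" and total: "total_on (Field ?r) ?r"
    and wf: "wf (?r - Id)"
    using wo by (auto simp: order_on_defs)
  show "OFCLASS(omega1, wellorder_class)"
  proof
    fix x y z :: omega1
    show "x \<le> x"
      by (simp add: less_eq_omega1_def refl Rep_omega1)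
    show "x \<le> z" if "x \<le> y" "y \<le> z"
      using that trans by (auto simp: less_eq_omega1_def dest: transD)
    show eq: "x = y" if "x \<le> y" "y \<le> x" for x y :: omega1
      using that antisym by (auto simp: less_eq_omega1_def Rep_omega1_inject dest: antisymD)
    show "x < y \<longleftrightarrow> x \<le> y \<and> \<not> y \<le> x"
      using eq[of x y] \<open>x \<le> x\<close> by (auto simp: less_omega1_def)
    show "x \<le> y \<or> y \<le> x"
    proof (cases "x = y")
      case False
      then show ?thesis
        using total Rep_omega1[of x] Rep_omega1[of y]
        by (auto simp: less_eq_omega1_def total_on_def Rep_omega1_inject)
    qed (use \<open>x \<le> x\<close> in auto)
  next
    fix P :: "omega1 \<Rightarrow> bool" and a
    assume step: "\<And>x. (\<And>y. y < x \<Longrightarrow> P y) \<Longrightarrow> P x"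
    have "wf (inv_image (?r - Id) Rep_omega1)"
      using wf by (rule wf_inv_image)
    then show "P a"
    proof (induction a rule: wf_induct_rule)
      case (less x)
      show ?case
        by (rule step, rule less)
           (auto simp: less_omega1_def less_eq_omega1_def in_inv_image Rep_omega1_inject)
    qed
  qed
qed

end

instantiation omega1 :: linorder_topology
begin

definition open_omega1 :: "omega1 set \<Rightarrow> bool" where
  "open_omega1 = generate_topology (range (\<lambda>a. {..<a}) \<union> range (\<lambda>a. {a<..}))"

instance by standard (rule open_omega1_def)

end

context includes cardinal_syntax
begin

lemma uncountable_omega1: "uncountable (UNIV :: omega1 set)"
proof
  assume "countable (UNIV :: omega1 set)"
  then have "countable (range Rep_omega1)"
    by (rule countable_image)
  then have "countable (Field (cardSuc natLeq))"
    by (simp add: type_definition.Rep_range[OF type_definition_omega1])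
  then have "|Field (cardSuc natLeq)| \<le>o |UNIV :: nat set|"
    unfolding countable_def card_of_ordLeq[symmetric] by auto
  then have "cardSuc natLeq \<le>o natLeq"
    using card_of_Field_ordIso[OF cardSuc_Card_order[OF natLeq_Card_order]] card_of_nat
    by (meson ordIso_iff_ordLeq ordLeq_transitive)
  then show False
    using cardSuc_greater[OF natLeq_Card_order] not_ordLess_ordLeq by blast
qed

lemma countable_lessThan_omega1: "countable {..<a :: omega1}"
proof -
  let ?r = "cardSuc natLeq"
  let ?S = "underS ?r (Rep_omega1 a)"
  have "|?S| <o ?r"
    using card_of_underS[OF cardSuc_Card_order[OF natLeq_Card_order] Rep_omega1] .
  then have "|?S| \<le>o natLeq"
    using cardSuc_ordLeq_ordLess[OF natLeq_Card_order card_of_Card_order] by blast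
  then have "|?S| \<le>o |UNIV :: nat set|"
    using card_of_nat ordIso_iff_ordLeq ordLeq_transitive by blast
  then have "countable ?S"
    unfolding countable_def card_of_ordLeq[symmetric] by auto
  moreover have "Rep_omega1 ` {..<a} \<subseteq> ?S"
    by (auto simp: underS_def less_omega1_def less_eq_omega1_def Rep_omega1_inject)
  ultimately have "countable (Rep_omega1 ` {..<a})"
    by (rule countable_subset[rotated])
  then show ?thesis
    by (rule countable_image_inj_on) (auto simp: inj_on_def Rep_omega1_inject)
qed

end

definition club :: "omega1 set \<Rightarrow> bool" where
  "club C \<longleftrightarrow> closed C \<and> (\<forall>a. \<exists>c\<in>C. a < c)"

definition stationary :: "omega1 set \<Rightarrow> bool" where
  "stationary S \<longleftrightarrow> (\<forall>C. club C \<longrightarrow> S \<inter> C \<noteq> {})"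

text \<open>Families are given as sets of sets: in an indexed discrete family only the empty set can
  be repeated, so nothing is lost. No separation axiom is included, in accordance with
  \<^const>\<open>normal_space\<close>; subspaces of \<open>omega1 \<times> omega1\<close> are Hausdorff anyway.\<close>

definition discrete_family :: "'a topology \<Rightarrow> 'a set set \<Rightarrow> bool" where
  "discrete_family X \<F> \<longleftrightarrow>
     (\<forall>x\<in>topspace X. \<exists>W. openin X W \<and> x \<in> W \<and>
        (\<forall>F\<in>\<F>. \<forall>G\<in>\<F>. F \<inter> W \<noteq> {} \<and> G \<inter> W \<noteq> {} \<longrightarrow> F = G))"

definition collectionwise_normal_space :: "'a topology \<Rightarrow> bool" where
  "collectionwise_normal_space X \<longleftrightarrow>
     (\<forall>\<F>. (\<forall>F\<in>\<F>. closedin X F) \<and> discrete_family X \<F> \<longrightarrow>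
        (\<exists>U. (\<forall>F\<in>\<F>. openin X (U F) \<and> F \<subseteq> U F) \<and> disjoint_family_on U \<F>))"

text \<open>Uniformities relative to a carrier set: the type class \<^class>\<open>uniform_space\<close> fixes one
  uniformity per type and so does not allow quantification over the compatible ones.\<close>

definition is_uniformity_on :: "'a set \<Rightarrow> ('a \<times> 'a) set set \<Rightarrow> bool" where
  "is_uniformity_on X \<UU> \<longleftrightarrow>
     X \<times> X \<in> \<UU> \<and>
     (\<forall>U\<in>\<UU>. Id_on X \<subseteq> U \<and> U \<subseteq> X \<times> X) \<and>
     (\<forall>U\<in>\<UU>. \<forall>V. U \<subseteq> V \<and> V \<subseteq> X \<times> X \<longrightarrow> V \<in> \<UU>) \<and>
     (\<forall>U\<in>\<UU>. \<forall>V\<in>\<UU>. U \<inter> V \<in> \<UU>) \<and>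
     (\<forall>U\<in>\<UU>. U\<inverse> \<in> \<UU>) \<and>
     (\<forall>U\<in>\<UU>. \<exists>V\<in>\<UU>. V O V \<subseteq> U)"

definition uniform_topology :: "'a set \<Rightarrow> ('a \<times> 'a) set set \<Rightarrow> 'a topology" where
  "uniform_topology X \<UU> =
     topology (\<lambda>W. W \<subseteq> X \<and> (\<forall>x\<in>W. \<exists>U\<in>\<UU>. U `` {x} \<subseteq> W))"

lemma openin_uniform_topology:
  assumes "is_uniformity_on X \<UU>"
  shows "openin (uniform_topology X \<UU>) W \<longleftrightarrow>
           W \<subseteq> X \<and> (\<forall>x\<in>W. \<exists>U\<in>\<UU>. U `` {x} \<subseteq> W)"
proof -
  let ?P = "\<lambda>W. W \<subseteq> X \<and> (\<forall>x\<in>W. \<exists>U\<in>\<UU>. U `` {x} \<subseteq> W)"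
  have Int: "?P (S \<inter> T)" if S: "?P S" and T: "?P T" for S T
  proof (intro conjI ballI)
    show "S \<inter> T \<subseteq> X"
      using S by auto
    fix x assume "x \<in> S \<inter> T"
    then have x: "x \<in> S" "x \<in> T"
      by auto
    obtain U where U: "U \<in> \<UU>" "U `` {x} \<subseteq> S"
      using bspec[OF conjunct2[OF S] x(1)] by (elim bexE)
    obtain V where V: "V \<in> \<UU>" "V `` {x} \<subseteq> T"
      using bspec[OF conjunct2[OF T] x(2)] by (elim bexE)
    have "\<forall>U\<in>\<UU>. \<forall>V\<in>\<UU>. U \<inter> V \<in> \<UU>"
      using assms unfolding is_uniformity_on_def by (elim conjE)
    then have "U \<inter> V \<in> \<UU>"
      using U(1) V(1) by auto
    moreover have "(U \<inter> V) `` {x} \<subseteq> S \<inter> T"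
      using U(2) V(2) by auto
    ultimately show "\<exists>U\<in>\<UU>. U `` {x} \<subseteq> S \<inter> T"
      by (rule rev_bexI)
  qed
  have Union: "?P (\<Union>\<K>)" if K: "\<forall>K\<in>\<K>. ?P K" for \<K>
  proof (intro conjI ballI)
    show "\<Union>\<K> \<subseteq> X"
      using K by (simp add: Sup_le_iff)
    fix x assume "x \<in> \<Union>\<K>"
    then obtain K where "K \<in> \<K>" "x \<in> K"
      by auto
    obtain U where U: "U \<in> \<UU>" "U `` {x} \<subseteq> K"
      using bspec[OF conjunct2[OF bspec[OF K \<open>K \<in> \<K>\<close>]] \<open>x \<in> K\<close>] by (elim bexE)
    show "\<exists>U\<in>\<UU>. U `` {x} \<subseteq> \<Union>\<K>"
      using U(1) order_trans[OF U(2) Union_upper[OF \<open>K \<in> \<K>\<close>]] by (rule rev_bexI)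
  qed
  have "istopology ?P"
    unfolding istopology_def
    by (rule conjI, (rule allI, rule allI, rule impI, rule impI, erule (1) Int),
        (rule allI, rule impI, erule Union))
  then show ?thesis
    unfolding uniform_topology_def by (simp only: topology_inverse')
qed

definition compatible_uniformity :: "'a topology \<Rightarrow> ('a \<times> 'a) set set \<Rightarrow> bool" where
  "compatible_uniformity T \<UU> \<longleftrightarrow>
     is_uniformity_on (topspace T) \<UU> \<and> uniform_topology (topspace T) \<UU> = T"

text \<open>A play of the proximal game is the pair of sequences \<open>U\<close> (player 1) and \<open>x\<close> (player 2).
  The entourages played are required to be symmetric members of the uniformity.\<close>

definition legal1 :: "('a \<times> 'a) set set \<Rightarrow> (nat \<Rightarrow> ('a \<times> 'a) set) \<Rightarrow> bool" where
  "legal1 \<UU> U \<longleftrightarrow> (\<forall>n. U n \<in> \<UU> \<and> sym (U n) \<and> U (Suc n) \<subseteq> U n)"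

definition legal2 :: "'a set \<Rightarrow> (nat \<Rightarrow> ('a \<times> 'a) set) \<Rightarrow> (nat \<Rightarrow> 'a) \<Rightarrow> bool" where
  "legal2 X U x \<longleftrightarrow> x 0 \<in> X \<and> (\<forall>n. x (Suc n) \<in> U n `` {x n})"

definition player1_wins ::
    "'a set \<Rightarrow> ('a \<times> 'a) set set \<Rightarrow> (nat \<Rightarrow> ('a \<times> 'a) set) \<Rightarrow> (nat \<Rightarrow> 'a) \<Rightarrow> bool" where
  "player1_wins X \<UU> U x \<longleftrightarrow>
     (\<Inter>n. U n `` {x n}) = {} \<or> (\<exists>l. limitin (uniform_topology X \<UU>) x l sequentially)"

text \<open>A strategy \<open>\<sigma>\<close> of player 2 maps the moves \<open>[U 0, \<dots>, U n]\<close> and \<open>[x 0, \<dots>, x (n - 1)]\<close>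
  made so far to \<open>x n\<close>. Legality of player 2's replies only has to be asked for in infinite plays,
  since every finite sequence of legal moves of player 1 extends to an infinite one by repetition
  of its last entry. On the empty space player 2 has no legal move and hence no winning
  strategy.\<close>

definition winning_strategy2 ::
    "'a set \<Rightarrow> ('a \<times> 'a) set set \<Rightarrow> (('a \<times> 'a) set list \<Rightarrow> 'a list \<Rightarrow> 'a) \<Rightarrow> bool" where
  "winning_strategy2 X \<UU> \<sigma> \<longleftrightarrow>
     (\<forall>U x. legal1 \<UU> U \<and> (\<forall>n. x n = \<sigma> (map U [0..<Suc n]) (map x [0..<n])) \<longrightarrow>
        legal2 X U x \<and> \<not> player1_wins X \<UU> U x)"

definition semi_proximal_uniform :: "'a set \<Rightarrow> ('a \<times> 'a) set set \<Rightarrow> bool" where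
  "semi_proximal_uniform X \<UU> \<longleftrightarrow> (\<nexists>\<sigma>. winning_strategy2 X \<UU> \<sigma>)"

definition semi_proximal_space :: "'a topology \<Rightarrow> bool" where
  "semi_proximal_space T \<longleftrightarrow>
     (\<exists>\<UU>. compatible_uniformity T \<UU> \<and> semi_proximal_uniform (topspace T) \<UU>)"

end

theory Submission
  imports Defs
begin

text \<open>
  The combinatorial engine is the pressing-down lemma, used in the form \<open>pressing_down\<close>: if
  every point \<open>s\<close> of a stationary set \<open>S\<close> has a neighbourhood with a property inherited
  by smaller sets, then for one fixed \<open>g\<close> the intervals \<open>{g<..s}\<close> have this property for
  stationarily many \<open>s\<close> in \<open>S\<close>.

  Condition (c) implies that \<open>A \<times> B\<close> is collectionwise normal because of a splitting theorem,
  \<open>splits_times\<close>: if each point has a neighbourhood on which a relation \<open>r\<close> holds between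
  any two points, then \<open>A \<times> B\<close> has a partition into open sets with the same property. For a
  discrete family, let \<open>r x y\<close> say that \<open>x\<close> and \<open>y\<close> do not lie in two different
  members; the saturations of the members are then open and disjoint. To split \<open>A \<times> B\<close>, cut
  it into clopen pieces. If \<open>A\<close> is not stationary, a disjoint club cuts it into countable
  pieces, and a countable set times anything is handled by countability and by pressing down in
  the other factor (\<open>splits_countable_times\<close>). If \<open>A \<inter> B\<close> is stationary, pressing down
  along the diagonal produces a square \<open>{g<..} \<times> {g<..}\<close> that need not be cut at all, and the
  rest consists of countable sets times others.

  Condition (c) implies that \<open>A \<times> B\<close> is semi-proximal for the uniformity generated by all open
  equivalence relations. Against a strategy of player 2, choose \<open>d < omega1\<close> closed under the
  replies of the strategy to moves built from finitely many cuts at ordinals below \<open>d\<close>, with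
  \<open>d\<close> in whichever of \<open>A\<close> and \<open>B\<close> are stationary, which is possible by (c). Player 1
  first cuts the nonstationary factors into countable pieces, and then cuts both factors
  successively at all ordinals below \<open>d\<close>. If a point \<open>z\<close> lies in all the sets
  \<open>U n `` {x n}\<close>, each coordinate of \<open>x n\<close> converges to the corresponding coordinate of
  \<open>z\<close>, or to \<open>d\<close> if that coordinate is not below \<open>d\<close>, which can happen only in
  a stationary factor.

  Now let \<open>A\<close> and \<open>B\<close> be stationary and let the club \<open>C\<close> be disjoint from
  \<open>A \<inter> B\<close>. Pressing down in both factors shows (\<open>small_tail\<close>) that for each entourage
  \<open>U\<close> all points \<open>(a, b)\<close> with \<open>a > c\<close> and \<open>b > g a\<close> are \<open>U\<close>-close to each
  other, for suitable \<open>c\<close> and \<open>g\<close>. Player 2 wins by playing such points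
  \<open>(a n, b n)\<close> with \<open>a n < b n < e n < a (n + 1)\<close> and \<open>e n \<in> C\<close>: a limit would have
  the form \<open>(p, p)\<close> with \<open>p \<in> A \<inter> B \<inter> C\<close>, while countably many tails have a common point.
  Moreover \<open>A \<times> B\<close> is not normal: with \<open>f a\<close> the least element of \<open>B\<close> above \<open>a\<close>,
  the graph of \<open>f\<close> over \<open>A \<inter> C\<close> and the set of all \<open>(a, b)\<close> such that
  each \<open>p < b\<close> lies below some element of \<open>B\<close> below \<open>b\<close> are closed and disjoint,
  and by pressing down they cannot be separated.
\<close>

section \<open>The order topology of the first uncountable ordinal\<close>

lemma countable_atMost_omega1: "countable {..a :: omega1}"
proof -
  have "{..a} = insert a {..<a}" by auto
  then show ?thesis using countable_lessThan_omega1[of a] by simp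
qed

lemma countable_bounded_omega1:
  fixes T :: "omega1 set"
  assumes "countable T"
  obtains b where "\<And>t. t \<in> T \<Longrightarrow> t < b"
proof -
  have "countable (\<Union>t\<in>T. {..t})"
    using assms countable_atMost_omega1 by blast
  then obtain b where "b \<notin> (\<Union>t\<in>T. {..t})"
    using uncountable_omega1 by (metis UNIV_eq_I)
  then show thesis
    using that[of b] by (auto simp: not_le)
qed

lemma ex_gt_omega1: "\<exists>b. (a :: omega1) < b"
  using countable_bounded_omega1[of "{a}"] by auto

lemma open_atMost_omega1: "open {..a :: omega1}"
proof -
  define b where "b = (LEAST b. a < b)"
  have "a < b"
    unfolding b_def using ex_gt_omega1 by (rule LeastI_ex)
  then have "{..a} = {..<b}"
    unfolding b_def using not_less_Least by fastforce
  then show ?thesis by simp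
qed

lemma open_Ioc_omega1: "open {p<..x :: omega1}"
  using open_Int[OF open_greaterThan open_atMost_omega1, of p x]
  by (simp add: greaterThanAtMost_def)

lemma closed_greaterThan_omega1: "closed {a :: omega1 <..}"
  using open_atMost_omega1[of a] by (simp add: closed_def Compl_greaterThan)

lemma closed_Ioc_omega1: "closed {p<..x :: omega1}"
  using closed_Int[OF closed_greaterThan_omega1 closed_atMost, of p x]
  by (simp add: greaterThanAtMost_def)

text \<open>A countable base of clopen neighbourhoods of \<open>x\<close>. The initial segment \<open>{..x}\<close> is
  needed for the least \<open>x\<close>, which has no interval \<open>{p<..x}\<close> around it.\<close>

definition intervals_to :: "omega1 \<Rightarrow> omega1 set set" where
  "intervals_to x = insert {..x} ((\<lambda>p. {p<..x}) ` {..<x})"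

lemma intervals_to_props:
  assumes "N \<in> intervals_to x"
  shows "open N" "closed N" "x \<in> N" "N \<subseteq> {..x}"
    and "\<And>y z. y \<in> N \<Longrightarrow> y \<le> z \<Longrightarrow> z \<le> x \<Longrightarrow> z \<in> N"
  using assms
  by (auto simp: intervals_to_def open_atMost_omega1 open_Ioc_omega1 closed_Ioc_omega1)

lemma countable_intervals_to: "countable (intervals_to x)"
  by (simp add: intervals_to_def countable_lessThan_omega1)

lemma intervals_to_base:
  assumes "open W" "x \<in> W"
  obtains N where "N \<in> intervals_to x" "N \<subseteq> W"
proof (cases "\<exists>y. y < x")
  case True
  then obtain y where "y < x" by auto
  then obtain p where "p < x" "{p<..x} \<subseteq> W"
    using open_left[OF assms] by blast
  then show ?thesis
    using that by (auto simp: intervals_to_def)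
next
  case False
  then have "{..x} = {x}"
    by (auto simp: not_less intro: antisym)
  then show ?thesis
    using that assms by (auto simp: intervals_to_def)
qed

lemma open_left_omega1:
  fixes x :: omega1
  assumes "open W" "x \<in> W" "y < x"
  obtains p where "p < x" "{p<..x} \<subseteq> W"
  using open_left[OF assms] that by blast

section \<open>Clubs, stationary sets and pressing down\<close>

text \<open>Countable sets of ordinals are bounded, and the bound can be chosen as a function of the
  parameter \<open>x\<close> on which the countable set depends.\<close>

lemma strict_bound_function:
  fixes h :: "'i \<Rightarrow> omega1" and I :: "omega1 \<Rightarrow> 'i set"
  assumes "\<And>x. countable (I x)"
  obtains H where "\<And>x i. i \<in> I x \<Longrightarrow> h i < H x"
proof -
  have "\<exists>b. \<forall>i\<in>I x. h i < b" for x
    using countable_bounded_omega1[of "h ` I x"] assms[of x] by (metis countable_image imageI)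
  then show thesis
    using that by metis
qed

lemma club_closure_points:
  fixes h :: "omega1 \<Rightarrow> omega1"
  shows "club {d. \<forall>x<d. h x < d}"
  unfolding club_def
proof (intro conjI allI)
  have "{d. \<forall>x<d. h x < d} = (\<Inter>x. {..x} \<union> {h x<..})"
    by (simp add: set_eq_iff) (meson leD leI)
  then show "closed {d. \<forall>x<d. h x < d}"
    by (simp only:) (intro closed_INT ballI closed_Un closed_atMost closed_greaterThan_omega1)
  fix a
  obtain H where H: "\<And>x i. i \<in> {..x} \<Longrightarrow> h i < H x"
    using strict_bound_function[of "\<lambda>x. {..x}" h] countable_atMost_omega1 by blast
  \<comment> \<open>The supremum of the iterates of the strict bound \<open>H\<close> above \<open>a\<close>
      is a closure point.\<close>
  define it where "it n = ((\<lambda>x. max x (H x)) ^^ n) a" for n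
  have it_Suc: "it (Suc n) = max (it n) (H (it n))" for n
    by (simp add: it_def)
  define d where "d = (LEAST d. \<forall>n. it n < d)"
  have "\<exists>d. \<forall>n. it n < d"
    using countable_bounded_omega1[of "range it"] by (metis countableI_type countable_image rangeI)
  then have "\<forall>n. it n < d"
    unfolding d_def by (rule LeastI_ex)
  then have d: "it n < d" for n
    by blast
  have "h x < d" if "x < d" for x
  proof -
    have "\<not> (\<forall>n. it n < x)"
      using that unfolding d_def by (rule not_less_Least)
    then obtain n where "x \<le> it n"
      by (auto simp: not_less)
    then have "h x < H (it n)"
      using H by auto
    also have "\<dots> \<le> it (Suc n)"
      by (simp add: it_Suc)
    finally show ?thesis
      using d less_trans by blast
  qed
  moreover have "a < d"
    using d[of 0] by (simp add: it_def)
  ultimately show "\<exists>c\<in>{d. \<forall>x<d. h x < d}. a < c"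
    by blast
qed

text \<open>The hypothesis \<open>y < d\<close> only says that \<open>d\<close> is not the least ordinal.\<close>

lemma club_memI:
  assumes "club C" "y < d" "\<And>x. x < d \<Longrightarrow> \<exists>c\<in>C. x < c \<and> c < d"
  shows "d \<in> C"
proof (rule ccontr)
  assume "d \<notin> C"
  then obtain p where "p < d" "{p<..d} \<subseteq> - C"
    using open_left_omega1[of "- C" d y] assms by (auto simp: club_def)
  then show False
    using assms(3)[of p] by fastforce
qed

lemma club_diagonal_Inter:
  assumes "\<And>x. club (C x)"
  shows "club {d. \<forall>x<d. d \<in> C x}"
  unfolding club_def
proof (intro conjI allI)
  have "{d. \<forall>x<d. d \<in> C x} = (\<Inter>x. {..x} \<union> C x)"
    by (simp add: set_eq_iff) (meson leD leI)
  then show "closed {d. \<forall>x<d. d \<in> C x}"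
    using assms unfolding club_def
    by (simp only:) (intro closed_INT ballI closed_Un closed_atMost, simp)
  fix a
  have "\<exists>c\<in>C x. y < c" for x y
    using assms by (auto simp: club_def)
  then obtain c where c: "\<And>x y. c x y \<in> C x" "\<And>x y. y < c x y"
    by metis
  obtain H where H: "\<And>x i. i \<in> {..x} \<times> {..x} \<Longrightarrow> case_prod c i < H x"
    using strict_bound_function[of "\<lambda>x. {..x} \<times> {..x}" "case_prod c"] countable_atMost_omega1
    by (metis countable_SIGMA)
  obtain d where d: "a < d" "\<And>x. x < d \<Longrightarrow> H x < d"
    using club_closure_points[of H] by (auto simp: club_def)
  have "d \<in> C x" if "x < d" for x
  proof (rule club_memI[OF assms d(1)])
    fix y assume "y < d"
    have "c x y < H (max x y)"
      using H[of "(x, y)" "max x y"] by simp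
    also have "\<dots> < d"
      using d(2) that \<open>y < d\<close> by (simp add: max_def)
    finally show "\<exists>c\<in>C x. y < c \<and> c < d"
      using c by blast
  qed
  then show "\<exists>c\<in>{d. \<forall>x<d. d \<in> C x}. a < c"
    using d by auto
qed

lemma club_INT:
  assumes "countable I" "\<And>i. i \<in> I \<Longrightarrow> club (C i)"
  shows "club (\<Inter>i\<in>I. C i)"
  unfolding club_def
proof (intro conjI allI)
  show "closed (\<Inter>i\<in>I. C i)"
    using assms by (auto simp: club_def)
  fix a
  have "\<forall>i\<in>I. \<forall>y. \<exists>c\<in>C i. y < c"
    using assms by (auto simp: club_def)
  then obtain c where c: "\<And>i y. i \<in> I \<Longrightarrow> c i y \<in> C i \<and> y < c i y"
    by metis
  obtain H where H: "\<And>x i. i \<in> I \<times> {x} \<Longrightarrow> case_prod c i < H x"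
    using strict_bound_function[of "\<lambda>x. I \<times> {x}" "case_prod c"] assms(1)
    by (metis countable_SIGMA countable_empty countable_insert)
  obtain d where d: "a < d" "\<And>x. x < d \<Longrightarrow> H x < d"
    using club_closure_points[of H] by (auto simp: club_def)
  have "d \<in> C i" if "i \<in> I" for i
  proof (rule club_memI[OF assms(2)[OF that] d(1)])
    fix y assume "y < d"
    have "c i y < H y"
      using H[of "(i, y)" y] that by simp
    also have "\<dots> < d"
      using d(2) \<open>y < d\<close> by simp
    finally show "\<exists>c\<in>C i. y < c \<and> c < d"
      using c that by blast
  qed
  then show "\<exists>c\<in>(\<Inter>i\<in>I. C i). a < c"
    using d by auto
qed

lemma club_UNIV: "club UNIV"
  using ex_gt_omega1 by (auto simp: club_def)

lemma club_Int: "club C \<Longrightarrow> club D \<Longrightarrow> club (C \<inter> D)"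
  using club_INT[of "{True, False}" "\<lambda>b. if b then C else D"]
  by (simp add: Int_commute)

lemma club_greaterThan: "club {a<..}"
  unfolding club_def
proof (intro conjI allI)
  show "\<exists>c\<in>{a<..}. x < c" for x
    using ex_gt_omega1[of "max a x"] by auto
qed (rule closed_greaterThan_omega1)

lemma stationary_Int_club:
  assumes "stationary S" "club C"
  shows "stationary (S \<inter> C)"
  using assms club_Int by (fastforce simp: stationary_def Int_assoc)

lemma stationary_meets_club:
  assumes "stationary S" "club C"
  obtains s where "s \<in> S" "s \<in> C" "a < s"
  using stationary_Int_club[OF assms] club_greaterThan[of a] by (fastforce simp: stationary_def)

lemma stationary_unbounded:
  assumes "stationary S"
  obtains s where "s \<in> S" "a < s"
  using stationary_meets_club[OF assms club_UNIV] by blast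

lemma stationary_pigeonhole:
  assumes "stationary S" "countable I" "f ` S \<subseteq> I"
  obtains i where "i \<in> I" "stationary {x \<in> S. f x = i}"
proof (rule ccontr)
  assume "\<not> thesis"
  then have "\<forall>i\<in>I. \<exists>C. club C \<and> {x \<in> S. f x = i} \<inter> C = {}"
    using that unfolding stationary_def by meson
  then obtain C where C: "\<And>i. i \<in> I \<Longrightarrow> club (C i) \<and> {x \<in> S. f x = i} \<inter> C i = {}"
    by metis
  obtain s where "s \<in> S" "s \<in> (\<Inter>i\<in>I. C i)"
    using stationary_meets_club[OF assms(1) club_INT[OF assms(2)]] C by metis
  then show False
    using C[of "f s"] assms(3) by auto
qed

text \<open>The premise \<open>y < x\<close> excludes the least ordinal, at which no function is regressive.\<close>

lemma Fodor:
  assumes "stationary S" "\<And>x y. x \<in> S \<Longrightarrow> y < x \<Longrightarrow> f x < x"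
  obtains g where "stationary {x \<in> S. f x = g}"
proof (rule ccontr)
  assume "\<not> thesis"
  then have "\<forall>g. \<exists>C. club C \<and> {x \<in> S. f x = g} \<inter> C = {}"
    using that unfolding stationary_def by meson
  then obtain C where C: "\<And>g. club (C g)" "\<And>g. {x \<in> S. f x = g} \<inter> C g = {}"
    by metis
  obtain s where s: "s \<in> S" "s \<in> {d. \<forall>x<d. d \<in> C x}" "undefined < s"
    using stationary_meets_club[OF assms(1) club_diagonal_Inter[OF C(1)]] .
  then show False
    using C(2)[of "f s"] assms(2)[of s] by auto
qed

lemma pressing_down:
  assumes "stationary S"
    and "\<And>x. x \<in> S \<Longrightarrow> \<exists>W. open W \<and> x \<in> W \<and> Q x W"
    and mono: "\<And>x V W. Q x W \<Longrightarrow> V \<subseteq> W \<Longrightarrow> Q x V"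
  obtains g where "stationary {x \<in> S. Q x {g<..x}}"
proof -
  have "\<exists>p. (\<exists>y. y < x) \<longrightarrow> p < x \<and> Q x {p<..x}" if x: "x \<in> S" for x
  proof -
    obtain W where W: "open W" "x \<in> W" "Q x W"
      using assms(2)[OF x] by blast
    show ?thesis
    proof (cases "\<exists>y. y < x")
      case True
      then obtain p where "p < x" "{p<..x} \<subseteq> W"
        using open_left_omega1[OF W(1,2)] by metis
      then show ?thesis
        using mono[OF W(3)] by blast
    qed blast
  qed
  then obtain f where f: "\<And>x y. x \<in> S \<Longrightarrow> y < x \<Longrightarrow> f x < x \<and> Q x {f x<..x}"
    by metis
  \<comment> \<open>Any bound will do to discard the least ordinal.\<close>
  define S' where "S' = S \<inter> {undefined<..}"
  have "stationary S'"
    unfolding S'_def using assms(1) club_greaterThan by (rule stationary_Int_club)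
  moreover have "f x < x" if "x \<in> S'" for x
    using f[of x undefined] that by (auto simp: S'_def)
  ultimately obtain g where g: "stationary {x \<in> S'. f x = g}"
    using Fodor[of S' f] by blast
  have "{x \<in> S'. f x = g} \<subseteq> {x \<in> S. Q x {g<..x}}"
    using f by (auto simp: S'_def)
  then have "stationary {x \<in> S. Q x {g<..x}}"
    using g unfolding stationary_def by blast
  then show thesis
    by (rule that)
qed

section \<open>Open equivalence relations\<close>

text \<open>The labels \<open>l y\<close> of the points of \<open>X\<close> near \<open>x\<close> agree with that of
  \<open>x\<close>, so that the fibres of \<open>l\<close> are clopen in \<open>X\<close>.\<close>

definition locally_constant_on :: "'a::topological_space set \<Rightarrow> ('a \<Rightarrow> 'b) \<Rightarrow> bool" where
  "locally_constant_on X l \<longleftrightarrow> (\<forall>x\<in>X. \<forall>\<^sub>F y in nhds x. y \<in> X \<longrightarrow> l y = l x)"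

text \<open>An equivalence relation on \<open>X\<close> whose classes are open in \<open>X\<close>: a partition of
  \<open>X\<close> into clopen pieces.\<close>

definition open_equiv :: "'a::topological_space set \<Rightarrow> ('a \<times> 'a) set \<Rightarrow> bool" where
  "open_equiv X E \<longleftrightarrow> equiv X E \<and> (\<forall>x\<in>X. \<forall>\<^sub>F y in nhds x. y \<in> X \<longrightarrow> (x, y) \<in> E)"

text \<open>The relation of having the same label.\<close>

definition kernel_on :: "'a set \<Rightarrow> ('a \<Rightarrow> 'b) \<Rightarrow> ('a \<times> 'a) set" where
  "kernel_on X l = {(x, y). x \<in> X \<and> y \<in> X \<and> l x = l y}"

lemma equiv_kernel_on: "equiv X (kernel_on X l)"
  by (rule equivI) (auto simp: kernel_on_def refl_on_def sym_def trans_def)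

lemma open_equiv_kernel_on:
  assumes "locally_constant_on X l"
  shows "open_equiv X (kernel_on X l)"
  unfolding open_equiv_def
proof (intro conjI ballI equiv_kernel_on)
  fix x assume "x \<in> X"
  then have "\<forall>\<^sub>F y in nhds x. y \<in> X \<longrightarrow> l y = l x"
    using assms by (auto simp: locally_constant_on_def)
  then show "\<forall>\<^sub>F y in nhds x. y \<in> X \<longrightarrow> (x, y) \<in> kernel_on X l"
    by eventually_elim (use \<open>x \<in> X\<close> in \<open>auto simp: kernel_on_def\<close>)
qed

lemma locally_constant_on_const: "locally_constant_on X (\<lambda>_. c)"
  by (simp add: locally_constant_on_def)

lemma locally_constant_on_Pair:
  assumes "locally_constant_on X l" "locally_constant_on X m"
  shows "locally_constant_on X (\<lambda>x. (l x, m x))"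
  unfolding locally_constant_on_def
proof
  fix x assume "x \<in> X"
  then have "\<forall>\<^sub>F y in nhds x. y \<in> X \<longrightarrow> l y = l x" "\<forall>\<^sub>F y in nhds x. y \<in> X \<longrightarrow> m y = m x"
    using assms by (auto simp: locally_constant_on_def)
  then show "\<forall>\<^sub>F y in nhds x. y \<in> X \<longrightarrow> (l y, m y) = (l x, m x)"
    by eventually_elim auto
qed

lemma locally_constant_on_fst:
  assumes "locally_constant_on A l"
  shows "locally_constant_on (A \<times> B) (\<lambda>z. l (fst z))"
  unfolding locally_constant_on_def
proof
  fix z assume "z \<in> A \<times> B"
  then have "\<forall>\<^sub>F y in nhds (fst z). y \<in> A \<longrightarrow> l y = l (fst z)"
    using assms by (auto simp: locally_constant_on_def)
  moreover have "filterlim fst (nhds (fst z)) (nhds z)"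
    by (intro tendsto_fst filterlim_ident)
  ultimately have "\<forall>\<^sub>F w in nhds z. fst w \<in> A \<longrightarrow> l (fst w) = l (fst z)"
    by (rule eventually_compose_filterlim)
  then show "\<forall>\<^sub>F w in nhds z. w \<in> A \<times> B \<longrightarrow> l (fst w) = l (fst z)"
    by eventually_elim auto
qed

lemma locally_constant_on_snd:
  assumes "locally_constant_on B l"
  shows "locally_constant_on (A \<times> B) (\<lambda>z. l (snd z))"
  unfolding locally_constant_on_def
proof
  fix z assume "z \<in> A \<times> B"
  then have "\<forall>\<^sub>F y in nhds (snd z). y \<in> B \<longrightarrow> l y = l (snd z)"
    using assms by (auto simp: locally_constant_on_def)
  moreover have "filterlim snd (nhds (snd z)) (nhds z)"
    by (intro tendsto_snd filterlim_ident)
  ultimately have "\<forall>\<^sub>F w in nhds z. snd w \<in> B \<longrightarrow> l (snd w) = l (snd z)"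
    by (rule eventually_compose_filterlim)
  then show "\<forall>\<^sub>F w in nhds z. w \<in> A \<times> B \<longrightarrow> l (snd w) = l (snd z)"
    by eventually_elim auto
qed

lemma locally_constant_on_mem_clopen:
  assumes "open W" "closed W"
  shows "locally_constant_on X (\<lambda>x. x \<in> W)"
  unfolding locally_constant_on_def
proof
  fix x assume "x \<in> X"
  have "\<forall>\<^sub>F y in nhds x. y \<in> (if x \<in> W then W else - W)"
    using assms by (intro eventually_nhds_in_open) auto
  then show "\<forall>\<^sub>F y in nhds x. y \<in> X \<longrightarrow> (y \<in> W) = (x \<in> W)"
    by eventually_elim (auto split: if_splits)
qed

text \<open>A countable clopen cover is disjointed by assigning to each point the first member that contains
  it.\<close>

lemma locally_constant_on_Least:
  fixes W :: "nat \<Rightarrow> 'a::topological_space set"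
  assumes W: "\<And>n. open (W n)" "\<And>n. closed (W n)" and cover: "X \<subseteq> (\<Union>n. W n)"
  shows "locally_constant_on X (\<lambda>x. LEAST n. x \<in> W n)"
  unfolding locally_constant_on_def
proof
  fix x assume "x \<in> X"
  define n where "n = (LEAST n. x \<in> W n)"
  have "x \<in> W n"
    unfolding n_def by (rule LeastI_ex) (use cover \<open>x \<in> X\<close> in auto)
  have "closed (\<Union>k<n. W k)"
    using W(2) by auto
  then have "open (W n - (\<Union>k<n. W k))"
    using W(1) by (rule open_Diff[rotated])
  moreover have "x \<in> W n - (\<Union>k<n. W k)"
    using \<open>x \<in> W n\<close> not_less_Least unfolding n_def by auto
  ultimately have "\<forall>\<^sub>F y in nhds x. y \<in> W n - (\<Union>k<n. W k)"
    by (rule eventually_nhds_in_open)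
  then have "\<forall>\<^sub>F y in nhds x. (LEAST n. y \<in> W n) = n"
  proof eventually_elim
    case (elim y)
    then show ?case
      by (intro Least_equality) (auto simp: not_less[symmetric])
  qed
  then show "\<forall>\<^sub>F y in nhds x. y \<in> X \<longrightarrow> (LEAST n. y \<in> W n) = (LEAST n. x \<in> W n)"
    unfolding n_def by eventually_elim auto
qed

section \<open>Splitting into cliques of a relation\<close>

text \<open>The relation \<open>r\<close> holds between any two points of \<open>W\<close>, in both orders, and
  between each point and itself.\<close>

definition clique_on :: "('a \<Rightarrow> 'a \<Rightarrow> bool) \<Rightarrow> 'a set \<Rightarrow> bool" where
  "clique_on r W \<longleftrightarrow> (\<forall>x\<in>W. \<forall>y\<in>W. r x y)"

text \<open>Each point of \<open>X\<close> has a neighbourhood in \<open>X\<close> that is a clique of \<open>r\<close>.\<close>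

definition locally_clique :: "('a::topological_space \<Rightarrow> 'a \<Rightarrow> bool) \<Rightarrow> 'a set \<Rightarrow> bool" where
  "locally_clique r X \<longleftrightarrow> (\<forall>x\<in>X. \<exists>W. open W \<and> x \<in> W \<and> clique_on r (W \<inter> X))"

text \<open>\<open>X\<close> has a partition into open sets, each of them a clique of \<open>r\<close>.\<close>

definition splits :: "('a::topological_space \<Rightarrow> 'a \<Rightarrow> bool) \<Rightarrow> 'a set \<Rightarrow> bool" where
  "splits r X \<longleftrightarrow> (\<exists>E. open_equiv X E \<and> (\<forall>(x, y)\<in>E. r x y))"

lemma clique_on_subset: "clique_on r W \<Longrightarrow> V \<subseteq> W \<Longrightarrow> clique_on r V"
  by (auto simp: clique_on_def)

lemma locally_cliqueE:
  assumes "locally_clique r X" "x \<in> X"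
  obtains W where "open W" "x \<in> W" "clique_on r (W \<inter> X)"
  using assms unfolding locally_clique_def by (elim ballE) auto

lemma locally_clique_subset: "locally_clique r X \<Longrightarrow> Y \<subseteq> X \<Longrightarrow> locally_clique r Y"
  unfolding locally_clique_def by (meson clique_on_subset inf_mono order_refl subsetD)

lemma splitsI:
  assumes "locally_constant_on X l" "\<And>x y. x \<in> X \<Longrightarrow> y \<in> X \<Longrightarrow> l x = l y \<Longrightarrow> r x y"
  shows "splits r X"
  unfolding splits_def
  by (rule exI[of _ "kernel_on X l"])
     (use assms open_equiv_kernel_on in \<open>auto simp: kernel_on_def\<close>)

lemma splits_glue:
  assumes l: "locally_constant_on X l"
    and fib: "\<And>x. x \<in> X \<Longrightarrow> splits r {y \<in> X. l y = l x}"
  shows "splits r X"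
proof -
  have "\<forall>i\<in>l ` X. \<exists>E. open_equiv {y \<in> X. l y = i} E \<and> (\<forall>(x, y)\<in>E. r x y)"
    using fib unfolding splits_def by auto
  then obtain E where "\<forall>i\<in>l ` X. open_equiv {y \<in> X. l y = i} (E i) \<and> (\<forall>(x, y)\<in>E i. r x y)"
    by metis
  then have E: "\<And>x. x \<in> X \<Longrightarrow> open_equiv {y \<in> X. l y = l x} (E (l x))"
    and r: "\<And>z x y. z \<in> X \<Longrightarrow> (x, y) \<in> E (l z) \<Longrightarrow> r x y"
    by auto
  have eq: "equiv {y \<in> X. l y = l x} (E (l x))" if "x \<in> X" for x
    using E[OF that] by (simp add: open_equiv_def)
  have sub: "E (l x) \<subseteq> {y \<in> X. l y = l x} \<times> {y \<in> X. l y = l x}" if "x \<in> X" for x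
    using eq[OF that] by (simp add: equiv_def)
  define D where "D = (\<Union>x\<in>X. E (l x))"
  have D: "(x, y) \<in> D \<longleftrightarrow> x \<in> X \<and> (x, y) \<in> E (l x)" for x y
    unfolding D_def using sub by fastforce
  have D': "x \<in> X \<and> y \<in> X \<and> l y = l x" if "(x, y) \<in> D" for x y
    using that sub unfolding D by blast
  have "equiv X D"
  proof (rule equivI)
    show "D \<subseteq> X \<times> X"
      using D' by auto
    show "refl_on X D"
      using eq by (auto simp: refl_on_def D equiv_def)
    show "sym D"
    proof (rule symI)
      fix x y assume xy: "(x, y) \<in> D"
      then show "(y, x) \<in> D"
        using eq[of x] D'[OF xy] unfolding D equiv_def by (metis symD)
    qed
    show "trans D"
    proof (rule transI)
      fix x y z assume xyz: "(x, y) \<in> D" "(y, z) \<in> D"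
      then show "(x, z) \<in> D"
        using eq[of x] D'[OF xyz(1)] unfolding D equiv_def by (metis transD)
    qed
  qed
  moreover have "\<forall>\<^sub>F y in nhds x. y \<in> X \<longrightarrow> (x, y) \<in> D" if x: "x \<in> X" for x
  proof -
    have "\<forall>\<^sub>F y in nhds x. y \<in> X \<longrightarrow> l y = l x"
      using l x by (auto simp: locally_constant_on_def)
    moreover have "\<forall>\<^sub>F y in nhds x. y \<in> {y \<in> X. l y = l x} \<longrightarrow> (x, y) \<in> E (l x)"
      using E[OF x] x unfolding open_equiv_def by blast
    ultimately show ?thesis
      by eventually_elim (use x in \<open>auto simp: D\<close>)
  qed
  ultimately have "open_equiv X D"
    by (simp add: open_equiv_def)
  moreover have "\<forall>(x, y)\<in>D. r x y"
    using D r by auto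
  ultimately show ?thesis
    unfolding splits_def by blast
qed

lemma splits_countable:
  fixes X :: "'a::topological_space set"
  assumes "countable X"
    and "\<And>x. x \<in> X \<Longrightarrow> \<exists>W. open W \<and> closed W \<and> x \<in> W \<and> clique_on r (W \<inter> X)"
  shows "splits r X"
proof (cases "X = {}")
  case True
  then show ?thesis
    by (intro splitsI[OF locally_constant_on_const]) auto
next
  case False
  obtain W where W: "\<And>x. x \<in> X \<Longrightarrow> open (W x) \<and> closed (W x) \<and> x \<in> W x \<and> clique_on r (W x \<inter> X)"
    using assms(2) by metis
  define e where "e = from_nat_into X"
  have e: "e n \<in> X" for n
    using False by (simp add: e_def from_nat_into)
  have cover: "X \<subseteq> (\<Union>n. W (e n))"
  proof
    fix x assume "x \<in> X"
    then obtain n where "x = e n"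
      using range_from_nat_into[OF False assms(1)] unfolding e_def by (metis imageE)
    then show "x \<in> (\<Union>n. W (e n))"
      using W \<open>x \<in> X\<close> by auto
  qed
  show ?thesis
  proof (rule splitsI)
    show "locally_constant_on X (\<lambda>x. LEAST n. x \<in> W (e n))"
      using W e cover by (intro locally_constant_on_Least) auto
    fix x y assume xy: "x \<in> X" "y \<in> X" "(LEAST n. x \<in> W (e n)) = (LEAST n. y \<in> W (e n))"
    have "z \<in> W (e (LEAST n. z \<in> W (e n)))" if "z \<in> X" for z
      by (rule LeastI_ex) (use that cover in auto)
    then have "\<exists>n. x \<in> W (e n) \<and> y \<in> W (e n)"
      using xy by metis
    then show "r x y"
      using W e xy(1,2) by (fastforce simp: clique_on_def)
  qed
qed

lemma splits_swap:
  fixes A :: "'a::topological_space set" and B :: "'b::topological_space set"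
  assumes "splits (\<lambda>x y. r (prod.swap x) (prod.swap y)) (B \<times> A)"
  shows "splits r (A \<times> B)"
proof -
  obtain E where "open_equiv (B \<times> A) E" "\<forall>(x, y)\<in>E. r (prod.swap x) (prod.swap y)"
    using assms unfolding splits_def by blast
  then have E: "equiv (B \<times> A) E"
    "\<And>x. x \<in> B \<times> A \<Longrightarrow> \<forall>\<^sub>F y in nhds x. y \<in> B \<times> A \<longrightarrow> (x, y) \<in> E"
    "\<And>x y. (x, y) \<in> E \<Longrightarrow> r (prod.swap x) (prod.swap y)"
    unfolding open_equiv_def by blast+
  define D where "D = {(x, y). (prod.swap x, prod.swap y) \<in> E}"
  have "equiv (A \<times> B) D"
  proof (rule equivI)
    show "D \<subseteq> (A \<times> B) \<times> (A \<times> B)"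
      using E(1) by (auto simp: D_def equiv_def)
    show "refl_on (A \<times> B) D"
      using E(1) by (auto simp: D_def equiv_def refl_on_def)
    show "sym D"
      using E(1) by (auto simp: D_def equiv_def sym_def)
    show "trans D"
      using E(1) unfolding D_def equiv_def trans_def by blast
  qed
  moreover have "\<forall>\<^sub>F y in nhds x. y \<in> A \<times> B \<longrightarrow> (x, y) \<in> D" if "x \<in> A \<times> B" for x
  proof -
    have "filterlim (\<lambda>y. (snd y, fst y)) (nhds (snd x, fst x)) (nhds x)"
      by (intro tendsto_Pair tendsto_fst tendsto_snd filterlim_ident)
    moreover have "\<forall>\<^sub>F y in nhds (snd x, fst x). y \<in> B \<times> A \<longrightarrow> ((snd x, fst x), y) \<in> E"
      using that by (intro E(2)) auto
    ultimately have "\<forall>\<^sub>F y in nhds x. (snd y, fst y) \<in> B \<times> A \<longrightarrow> ((snd x, fst x), (snd y, fst y)) \<in> E"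
      using eventually_compose_filterlim by blast
    then show ?thesis
      by eventually_elim (auto simp: D_def prod.swap_def)
  qed
  ultimately show ?thesis
    unfolding splits_def open_equiv_def
    by (intro exI[of _ D]) (use E(3) in \<open>force simp: D_def\<close>)
qed

lemma locally_clique_swap:
  fixes A :: "'a::topological_space set" and B :: "'b::topological_space set"
  assumes "locally_clique r (A \<times> B)"
  shows "locally_clique (\<lambda>x y. r (prod.swap x) (prod.swap y)) (B \<times> A)"
  unfolding locally_clique_def
proof
  fix x assume "x \<in> B \<times> A"
  then have "prod.swap x \<in> A \<times> B"
    by auto
  with assms obtain W where W: "open W" "prod.swap x \<in> W" "clique_on r (W \<inter> A \<times> B)"
    by (rule locally_cliqueE)
  have "open (prod.swap -` W)"
    using W(1)
    by (rule open_vimage) (rule continuous_on_swap)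
  moreover have "clique_on (\<lambda>x y. r (prod.swap x) (prod.swap y)) (prod.swap -` W \<inter> B \<times> A)"
    using W(3) by (auto simp: clique_on_def)
  ultimately show "\<exists>W. open W \<and> x \<in> W \<and> clique_on (\<lambda>x y. r (prod.swap x) (prod.swap y)) (W \<inter> B \<times> A)"
    using W(2) by (intro exI[of _ "prod.swap -` W"]) auto
qed

section \<open>Splitting products of subsets of the first uncountable ordinal\<close>

text \<open>A nonstationary set is a disjoint union of countable open pieces: label each point by the part of
  a disjoint club above it. A piece is bounded by the next element \<open>n a\<close> of the club.\<close>

lemma nonstationary_label:
  assumes "\<not> stationary A"
  obtains l :: "omega1 \<Rightarrow> omega1 set" and n where
    "locally_constant_on A l" "\<And>a z. l z = l a \<Longrightarrow> z < n a"
proof -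
  obtain C where C: "club C" "A \<inter> C = {}"
    using assms by (auto simp: stationary_def)
  then have "\<forall>a. \<exists>c\<in>C. a < c"
    by (simp add: club_def)
  then obtain n where n: "\<And>a. n a \<in> C" "\<And>a. a < n a"
    by metis
  define l where "l x = {c \<in> C. x < c}" for x
  have "locally_constant_on A l"
    unfolding locally_constant_on_def
  proof
    fix x assume "x \<in> A"
    then have "open (- C)" "x \<in> - C"
      using C by (auto simp: club_def)
    then obtain N where N: "N \<in> intervals_to x" "N \<subseteq> - C"
      by (rule intervals_to_base)
    note N' = intervals_to_props[OF N(1)]
    have "\<forall>\<^sub>F y in nhds x. y \<in> N"
      using N'(1,3) by (rule eventually_nhds_in_open)
    then show "\<forall>\<^sub>F y in nhds x. y \<in> A \<longrightarrow> l y = l x"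
    proof eventually_elim
      case (elim y)
      have "y < c \<longleftrightarrow> x < c" if "c \<in> C" for c
        using N'(4,5) N(2) elim that by (metis ComplD atMost_iff le_less_trans less_imp_le not_less subsetD)
      then show ?case
        by (auto simp: l_def)
    qed
  qed
  moreover have "z < n a" if "l z = l a" for a z
    using that n by (auto simp: l_def)
  ultimately show thesis
    by (rule that)
qed

lemma locally_constant_on_le: "locally_constant_on X (\<lambda>x :: omega1. x \<le> q)"
  using locally_constant_on_mem_clopen[OF open_atMost_omega1 closed_atMost] by simp

lemma open_prod_intervals:
  fixes x y :: omega1
  assumes "open W" "(x, y) \<in> W"
  obtains N M where "N \<in> intervals_to x" "M \<in> intervals_to y" "N \<times> M \<subseteq> W"
proof -
  obtain S T where ST: "open S" "open T" "(x, y) \<in> S \<times> T" "S \<times> T \<subseteq> W"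
    using open_prod_elim[OF assms] .
  obtain N where N: "N \<in> intervals_to x" "N \<subseteq> S"
    using intervals_to_base[OF ST(1), of x] ST(3) by auto
  obtain M where M: "M \<in> intervals_to y" "M \<subseteq> T"
    using intervals_to_base[OF ST(2), of y] ST(3) by auto
  have "N \<times> M \<subseteq> W"
    using Sigma_mono[OF N(2) M(2)] ST(4) by (rule subset_trans)
  then show thesis
    using N(1) M(1) by (rule that[rotated 2])
qed

lemma open_prod_clopen:
  fixes z :: "omega1 \<times> omega1"
  assumes "open W" "z \<in> W"
  obtains V where "open V" "closed V" "z \<in> V" "V \<subseteq> W"
proof -
  obtain x y where z: "z = (x, y)"
    by (rule prod.exhaust)
  obtain N M where NM: "N \<in> intervals_to x" "M \<in> intervals_to y" "N \<times> M \<subseteq> W"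
    using assms(1) assms(2)[unfolded z] by (rule open_prod_intervals)
  show thesis
  proof (rule that)
    show "open (N \<times> M)" "closed (N \<times> M)" "z \<in> N \<times> M"
      using intervals_to_props(1-3)[OF NM(1)] intervals_to_props(1-3)[OF NM(2)]
      by (simp_all add: open_Times closed_Times z)
  qed (rule NM(3))
qed

lemma splits_countable_omega1:
  fixes X :: "(omega1 \<times> omega1) set"
  assumes "countable X" "locally_clique r X"
  shows "splits r X"
proof (rule splits_countable[OF assms(1)])
  fix x assume "x \<in> X"
  with assms(2) obtain W where W: "open W" "x \<in> W" "clique_on r (W \<inter> X)"
    by (rule locally_cliqueE)
  obtain V where "open V" "closed V" "x \<in> V" "V \<subseteq> W"
    using open_prod_clopen[OF W(1,2)] .
  then show "\<exists>W. open W \<and> closed W \<and> x \<in> W \<and> clique_on r (W \<inter> X)"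
    using clique_on_subset[OF W(3), of "V \<inter> X"] by (intro exI[of _ V]) auto
qed

text \<open>The pieces of a nonstationary factor are countable, so it suffices to split over countable
  subsets of it.\<close>

lemma splits_nonstationary_left:
  fixes A B :: "omega1 set"
  assumes "\<not> stationary A"
    and "\<And>A'. countable A' \<Longrightarrow> A' \<subseteq> A \<Longrightarrow> splits r (A' \<times> B)"
  shows "splits r (A \<times> B)"
proof -
  obtain l :: "omega1 \<Rightarrow> omega1 set" and n where
    l: "locally_constant_on A l" "\<And>a z. l z = l a \<Longrightarrow> z < n a"
    using nonstationary_label[OF assms(1)] by metis
  show ?thesis
  proof (rule splits_glue[OF locally_constant_on_fst[OF l(1)]])
    fix x assume "x \<in> A \<times> B"
    have "{a \<in> A. l a = l (fst x)} \<subseteq> {..<n (fst x)}"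
      using l(2) by auto
    then have "countable {a \<in> A. l a = l (fst x)}"
      using countable_lessThan_omega1 by (rule countable_subset)
    then have "splits r ({a \<in> A. l a = l (fst x)} \<times> B)"
      by (rule assms(2)) auto
    also have "{a \<in> A. l a = l (fst x)} \<times> B = {y \<in> A \<times> B. l (fst y) = l (fst x)}"
      by (rule set_eqI) (simp add: mem_Times_iff conj_ac)
    finally show "splits r {y \<in> A \<times> B. l (fst y) = l (fst x)}" .
  qed
qed

text \<open>Over a fixed \<open>a\<close> there are only countably many basic neighbourhoods, so one of them works
  for stationarily many \<open>b\<close>; pressing down then makes it work for all large \<open>b\<close>.\<close>

lemma strip_clique:
  fixes A B :: "omega1 set"
  assumes "stationary B" "locally_clique r (A \<times> B)" "a \<in> A"
  obtains N g where "N \<in> intervals_to a" "clique_on r ((N \<inter> A) \<times> ({g<..} \<inter> B))"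
proof -
  have "\<exists>N\<in>intervals_to a. \<exists>M\<in>intervals_to b. clique_on r ((N \<inter> A) \<times> (M \<inter> B))" if "b \<in> B" for b
  proof -
    have "(a, b) \<in> A \<times> B"
      using that assms(3) by simp
    with assms(2) obtain W where W: "open W" "(a, b) \<in> W" "clique_on r (W \<inter> A \<times> B)"
      by (rule locally_cliqueE)
    obtain N M where "N \<in> intervals_to a" "M \<in> intervals_to b" "N \<times> M \<subseteq> W"
      using open_prod_intervals[OF W(1,2)] .
    moreover then have "clique_on r ((N \<inter> A) \<times> (M \<inter> B))"
      by (intro clique_on_subset[OF W(3)]) auto
    ultimately show ?thesis
      by blast
  qed
  then obtain f where f: "\<And>b. b \<in> B \<Longrightarrow> f b \<in> intervals_to a"
    "\<And>b. b \<in> B \<Longrightarrow> \<exists>M\<in>intervals_to b. clique_on r ((f b \<inter> A) \<times> (M \<inter> B))"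
    by metis
  obtain N where N: "N \<in> intervals_to a" "stationary {b \<in> B. f b = N}"
    using stationary_pigeonhole[OF assms(1) countable_intervals_to[of a], of f] f(1) by blast
  have strip: "\<exists>W. open W \<and> b \<in> W \<and> clique_on r ((N \<inter> A) \<times> (W \<inter> B))" if b: "b \<in> {b \<in> B. f b = N}" for b
  proof -
    obtain M where "M \<in> intervals_to b" "clique_on r ((N \<inter> A) \<times> (M \<inter> B))"
      using b f(2)[of b] by auto
    then show ?thesis
      using intervals_to_props(1,3) by (intro exI[of _ M]) auto
  qed
  obtain g where
    g: "stationary {b \<in> {b \<in> B. f b = N}. clique_on r ((N \<inter> A) \<times> ({g<..b} \<inter> B))}"
  proof (rule pressing_down[OF N(2) strip])
    show "clique_on r ((N \<inter> A) \<times> (V \<inter> B))"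
      if "clique_on r ((N \<inter> A) \<times> (W \<inter> B))" "V \<subseteq> W" for V W
      using that(1) by (rule clique_on_subset) (use that(2) in auto)
  qed
  have "r x y" if xy: "x \<in> (N \<inter> A) \<times> ({g<..} \<inter> B)" "y \<in> (N \<inter> A) \<times> ({g<..} \<inter> B)" for x y
  proof -
    obtain b where "clique_on r ((N \<inter> A) \<times> ({g<..b} \<inter> B))" "max (snd x) (snd y) < b"
      using stationary_unbounded[OF g] by blast
    moreover have "x \<in> (N \<inter> A) \<times> ({g<..b} \<inter> B)" "y \<in> (N \<inter> A) \<times> ({g<..b} \<inter> B)"
      using xy \<open>max (snd x) (snd y) < b\<close> by (auto simp: mem_Times_iff)
    ultimately show ?thesis
      by (auto simp: clique_on_def)
  qed
  then show thesis
    using that[OF N(1), of g] by (auto simp: clique_on_def)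
qed

lemma splits_countable_times:
  fixes A B :: "omega1 set"
  assumes A: "countable A" and r: "locally_clique r (A \<times> B)"
  shows "splits r (A \<times> B)"
proof (cases "stationary B")
  case False
  show ?thesis
  proof (rule splits_swap, rule splits_nonstationary_left[OF False])
    fix B' assume "countable B'" "B' \<subseteq> B"
    then have "locally_clique (\<lambda>x y. r (prod.swap x) (prod.swap y)) (B' \<times> A)"
      by (intro locally_clique_subset[OF locally_clique_swap[OF r]]) auto
    then show "splits (\<lambda>x y. r (prod.swap x) (prod.swap y)) (B' \<times> A)"
      using A \<open>countable B'\<close> by (intro splits_countable_omega1) auto
  qed
next
  case True
  have "\<exists>g. \<exists>N\<in>intervals_to a. clique_on r ((N \<inter> A) \<times> ({g<..} \<inter> B))" if "a \<in> A" for a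
    using strip_clique[OF True r that] by blast
  then obtain g where g: "\<And>a. a \<in> A \<Longrightarrow> \<exists>N\<in>intervals_to a. clique_on r ((N \<inter> A) \<times> ({g a<..} \<inter> B))"
    by metis
  obtain h where h: "\<And>a. a \<in> A \<Longrightarrow> g a < h"
    using countable_bounded_omega1[of "g ` A"] A by (metis countable_image imageI)
  show ?thesis
  proof (rule splits_glue)
    show "locally_constant_on (A \<times> B) (\<lambda>x. snd x \<le> h)"
      using locally_constant_on_snd[OF locally_constant_on_le] .
    fix x assume "x \<in> A \<times> B"
    show "splits r {y \<in> A \<times> B. (snd y \<le> h) = (snd x \<le> h)}"
    proof (cases "snd x \<le> h")
      case True
      then have *: "{y \<in> A \<times> B. (snd y \<le> h) = (snd x \<le> h)} = A \<times> (B \<inter> {..h})"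
        by auto
      have "countable (A \<times> (B \<inter> {..h}))"
        using A countable_atMost_omega1[of h] by (intro countable_SIGMA) (auto intro: countable_subset)
      then show ?thesis
        unfolding * by (rule splits_countable_omega1) (rule locally_clique_subset[OF r], auto)
    next
      case False
      then have *: "{y \<in> A \<times> B. (snd y \<le> h) = (snd x \<le> h)} = A \<times> ({h<..} \<inter> B)"
        by auto
      \<comment> \<open>Strips over all \<open>a \<in> A\<close> now have the common bound \<open>h\<close>, so
          the problem is one on \<open>A\<close>.\<close>
      define r' where "r' a a' \<longleftrightarrow> (\<forall>b\<in>{h<..} \<inter> B. \<forall>b'\<in>{h<..} \<inter> B. r (a, b) (a', b'))" for a a'
      have "splits r' A"
      proof (rule splits_countable[OF A])
        fix a assume a: "a \<in> A"
        obtain N where N: "N \<in> intervals_to a" "clique_on r ((N \<inter> A) \<times> ({g a<..} \<inter> B))"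
          using g[OF a] by blast
        have "clique_on r' (N \<inter> A)"
          using N(2) less_trans[OF h[OF a]] by (auto simp: clique_on_def r'_def)
        then show "\<exists>W. open W \<and> closed W \<and> a \<in> W \<and> clique_on r' (W \<inter> A)"
          using intervals_to_props[OF N(1)] by blast
      qed
      then obtain E where E: "open_equiv A E" "\<And>a a'. (a, a') \<in> E \<Longrightarrow> r' a a'"
        unfolding splits_def by auto
      have eq: "equiv A E"
        using E(1) by (simp add: open_equiv_def)
      show ?thesis
        unfolding *
      proof (rule splitsI)
        have "locally_constant_on A (\<lambda>a. E `` {a})"
          unfolding locally_constant_on_def
        proof
          fix a assume "a \<in> A"
          then have "\<forall>\<^sub>F y in nhds a. y \<in> A \<longrightarrow> (a, y) \<in> E"
            using E(1) by (auto simp: open_equiv_def)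
          then show "\<forall>\<^sub>F y in nhds a. y \<in> A \<longrightarrow> E `` {y} = E `` {a}"
            by eventually_elim (use eq in \<open>auto dest: equiv_class_eq\<close>)
        qed
        then show "locally_constant_on (A \<times> ({h<..} \<inter> B)) (\<lambda>x. E `` {fst x})"
          by (rule locally_constant_on_fst)
        fix x y assume xy: "x \<in> A \<times> ({h<..} \<inter> B)" "y \<in> A \<times> ({h<..} \<inter> B)" "E `` {fst x} = E `` {fst y}"
        then have "r' (fst x) (fst y)"
          using E(2) eq_equiv_class[OF xy(3) eq] by (auto simp: mem_Times_iff)
        then show "r x y"
          using xy(1,2) by (auto simp: r'_def)
      qed
    qed
  qed
qed

lemma splits_nonstationary_times:
  fixes A B :: "omega1 set"
  assumes "\<not> stationary A" "locally_clique r (A \<times> B)"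
  shows "splits r (A \<times> B)"
  using assms(1)
proof (rule splits_nonstationary_left)
  fix A' assume "countable A'" "A' \<subseteq> A"
  then show "splits r (A' \<times> B)"
    by (intro splits_countable_times locally_clique_subset[OF assms(2)]) auto
qed

lemma splits_times_stationary_Int:
  fixes A B :: "omega1 set"
  assumes AB: "stationary (A \<inter> B)" and r: "locally_clique r (A \<times> B)"
  shows "splits r (A \<times> B)"
proof -
  have square: "\<exists>W. open W \<and> x \<in> W \<and> clique_on r ((W \<times> W) \<inter> A \<times> B)" if "x \<in> A \<inter> B" for x
  proof -
    have "(x, x) \<in> A \<times> B"
      using that by simp
    with r obtain W where W: "open W" "(x, x) \<in> W" "clique_on r (W \<inter> A \<times> B)"
      by (rule locally_cliqueE)
    obtain S T where "open S" "open T" "(x, x) \<in> S \<times> T" "S \<times> T \<subseteq> W"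
      using open_prod_elim[OF W(1,2)] .
    moreover then have "clique_on r (((S \<inter> T) \<times> (S \<inter> T)) \<inter> A \<times> B)"
      by (intro clique_on_subset[OF W(3)]) auto
    ultimately show ?thesis
      by (intro exI[of _ "S \<inter> T"]) auto
  qed
  obtain g where g: "stationary {x \<in> A \<inter> B. clique_on r (({g<..x} \<times> {g<..x}) \<inter> A \<times> B)}"
  proof (rule pressing_down[OF AB square])
    show "clique_on r ((V \<times> V) \<inter> A \<times> B)"
      if "clique_on r ((W \<times> W) \<inter> A \<times> B)" "V \<subseteq> W" for V W
      using that(1) by (rule clique_on_subset) (use that(2) in auto)
  qed
  have tail: "r x y" if xy: "x \<in> A \<times> B" "y \<in> A \<times> B" "g < fst x" "g < snd x" "g < fst y" "g < snd y" for x y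
  proof -
    obtain s where s: "clique_on r (({g<..s} \<times> {g<..s}) \<inter> A \<times> B)"
      "max (max (fst x) (snd x)) (max (fst y) (snd y)) < s"
      using stationary_unbounded[OF g] by blast
    have "x \<in> ({g<..s} \<times> {g<..s}) \<inter> A \<times> B" "y \<in> ({g<..s} \<times> {g<..s}) \<inter> A \<times> B"
      using xy s(2) by (auto simp: mem_Times_iff)
    then show ?thesis
      using s(1) by (auto simp: clique_on_def)
  qed
  have le: "countable (S \<inter> {..g})" for S
    using countable_atMost_omega1 by (rule countable_subset[rotated]) auto
  show ?thesis
  proof (rule splits_glue)
    show "locally_constant_on (A \<times> B) (\<lambda>x. (fst x \<le> g, snd x \<le> g))"
      by (intro locally_constant_on_Pair locally_constant_on_fst[OF locally_constant_on_le]
          locally_constant_on_snd[OF locally_constant_on_le])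
    fix x assume "x \<in> A \<times> B"
    define Y where "Y = {y \<in> A \<times> B. (fst y \<le> g, snd y \<le> g) = (fst x \<le> g, snd x \<le> g)}"
    have clique: "locally_clique r (A' \<times> B')" if "A' \<subseteq> A" "B' \<subseteq> B" for A' B'
      using that by (intro locally_clique_subset[OF r]) auto
    consider "fst x \<le> g" | "g < fst x" "snd x \<le> g" | "g < fst x" "g < snd x"
      by force
    then have "splits r Y"
    proof cases
      case 1
      then have "Y = (A \<inter> {..g}) \<times> {b \<in> B. (b \<le> g) = (snd x \<le> g)}"
        by (auto simp: Y_def)
      then show ?thesis
        by (simp only:) (rule splits_countable_times[OF le clique], auto)
    next
      case 2
      then have *: "Y = {a \<in> A. \<not> a \<le> g} \<times> (B \<inter> {..g})"
        by (auto simp: Y_def)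
      show ?thesis
        unfolding *
        by (rule splits_swap, rule splits_countable_times[OF le],
            rule locally_clique_swap, rule clique) auto
    next
      case 3
      then show ?thesis
        by (intro splitsI[OF locally_constant_on_const] tail) (auto simp: Y_def)
    qed
    then show "splits r {y \<in> A \<times> B. (fst y \<le> g, snd y \<le> g) = (fst x \<le> g, snd x \<le> g)}"
      by (simp add: Y_def)
  qed
qed

lemma splits_times:
  fixes A B :: "omega1 set"
  assumes "\<not> stationary A \<or> \<not> stationary B \<or> stationary (A \<inter> B)" and r: "locally_clique r (A \<times> B)"
  shows "splits r (A \<times> B)"
  using assms splits_nonstationary_times[of A r B] splits_times_stationary_Int[of A B r]
    splits_swap[OF splits_nonstationary_times, OF _ locally_clique_swap[OF r]]
  by blast

lemma openin_open_equiv_class: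
  assumes "open_equiv X E"
  shows "openin (top_of_set X) (E `` F)"
proof -
  have eq: "equiv X E"
    using assms by (simp add: open_equiv_def)
  have nbhd: "\<exists>T. open T \<and> y \<in> T \<and> T \<inter> X \<subseteq> E `` F" if y: "y \<in> E `` F" for y
  proof -
    obtain x where x: "x \<in> F" "(x, y) \<in> E"
      using y by auto
    then have "y \<in> X"
      using eq by (auto simp: equiv_def)
    then have "\<forall>\<^sub>F z in nhds y. z \<in> X \<longrightarrow> (y, z) \<in> E"
      using assms by (auto simp: open_equiv_def)
    then obtain T where T: "open T" "y \<in> T" "\<forall>z\<in>T. z \<in> X \<longrightarrow> (y, z) \<in> E"
      by (auto simp: eventually_nhds)
    have "z \<in> E `` F" if z: "z \<in> T \<inter> X" for z
    proof -
      have "(y, z) \<in> E"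
        using T(3) z by blast
      then have "(x, z) \<in> E"
        using x(2) eq by (meson equiv_def transD)
      then show ?thesis
        using x(1) by blast
    qed
    then show ?thesis
      using T(1,2) by blast
  qed
  have sub: "E `` F \<subseteq> X"
    using eq by (auto simp: equiv_def)
  have "\<exists>T. openin (top_of_set X) T \<and> y \<in> T \<and> T \<subseteq> E `` F" if y: "y \<in> E `` F" for y
  proof -
    obtain T where "open T" "y \<in> T" "T \<inter> X \<subseteq> E `` F"
      using nbhd[OF y] by blast
    then show ?thesis
      using y sub by (intro exI[of _ "X \<inter> T"] conjI openin_open_Int) auto
  qed
  then show ?thesis
    by (subst openin_subopen) blast
qed

section \<open>Collectionwise normality\<close>

lemma collectionwise_normal_times:
  fixes A B :: "omega1 set"
  assumes "\<not> stationary A \<or> \<not> stationary B \<or> stationary (A \<inter> B)"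
  shows "collectionwise_normal_space (top_of_set (A \<times> B))"
  unfolding collectionwise_normal_space_def
proof (intro allI impI, elim conjE)
  fix \<F> assume closed: "\<forall>F\<in>\<F>. closedin (top_of_set (A \<times> B)) F"
    and discrete: "discrete_family (top_of_set (A \<times> B)) \<F>"
  define r where "r x y \<longleftrightarrow> (\<forall>F\<in>\<F>. \<forall>G\<in>\<F>. x \<in> F \<and> y \<in> G \<longrightarrow> F = G)" for x y
  have "locally_clique r (A \<times> B)"
    unfolding locally_clique_def
  proof
    fix x assume "x \<in> A \<times> B"
    then have x: "x \<in> topspace (top_of_set (A \<times> B))"
      by simp
    obtain W where W: "openin (top_of_set (A \<times> B)) W" "x \<in> W"
      "\<forall>F\<in>\<F>. \<forall>G\<in>\<F>. F \<inter> W \<noteq> {} \<and> G \<inter> W \<noteq> {} \<longrightarrow> F = G"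
      using bspec[OF discrete[unfolded discrete_family_def] x] by (elim exE conjE)
    have "clique_on r W"
      unfolding clique_on_def r_def using W(3) by blast
    moreover obtain T where "open T" "W = T \<inter> A \<times> B"
      using W(1) unfolding openin_open by blast
    ultimately show "\<exists>W. open W \<and> x \<in> W \<and> clique_on r (W \<inter> A \<times> B)"
      using W(2) by auto
  qed
  then have "splits r (A \<times> B)"
    using assms by (intro splits_times)
  then obtain E where E: "open_equiv (A \<times> B) E" "\<And>x y. (x, y) \<in> E \<Longrightarrow> r x y"
    unfolding splits_def by auto
  have eq: "equiv (A \<times> B) E"
    using E(1) by (simp add: open_equiv_def)
  show "\<exists>U. (\<forall>F\<in>\<F>. openin (top_of_set (A \<times> B)) (U F) \<and> F \<subseteq> U F) \<and> disjoint_family_on U \<F>"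
  proof (intro exI[of _ "\<lambda>F. E `` F"] conjI ballI)
    fix F assume "F \<in> \<F>"
    show "openin (top_of_set (A \<times> B)) (E `` F)"
      using openin_open_equiv_class[OF E(1)] .
    have "F \<subseteq> A \<times> B"
      using closed \<open>F \<in> \<F>\<close> closedin_imp_subset by blast
    then show "F \<subseteq> E `` F"
      using equiv_class_self[OF eq] by blast
  next
    show "disjoint_family_on (\<lambda>F. E `` F) \<F>"
      unfolding disjoint_family_on_def
    proof (intro ballI impI, rule ccontr)
      fix F G assume FG: "F \<in> \<F>" "G \<in> \<F>" "F \<noteq> G" "E `` F \<inter> E `` G \<noteq> {}"
      then obtain x y z where "x \<in> F" "y \<in> G" "(x, z) \<in> E" "(y, z) \<in> E"
        by auto
      then have "(x, y) \<in> E"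
        using eq unfolding equiv_def by (meson symD transD)
      then show False
        using E(2) FG \<open>x \<in> F\<close> \<open>y \<in> G\<close> unfolding r_def by blast
    qed
  qed
qed

lemma collectionwise_normal_imp_normal:
  assumes "collectionwise_normal_space X"
  shows "normal_space X"
  unfolding normal_space_def
proof (intro allI impI, elim conjE)
  fix S T assume ST: "closedin X S" "closedin X T" "disjnt S T"
  show "\<exists>U V. openin X U \<and> openin X V \<and> S \<subseteq> U \<and> T \<subseteq> V \<and> disjnt U V"
  proof (cases "S = T")
    case True
    then show ?thesis
      using ST by (intro exI[of _ "{}"]) (auto simp: disjnt_def)
  next
    case False
    have "discrete_family X {S, T}"
      unfolding discrete_family_def
    proof
      fix x assume "x \<in> topspace X"
      define W where "W = topspace X - (if x \<in> S then T else S)"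
      have "openin X W" "x \<in> W"
        using ST \<open>x \<in> topspace X\<close> by (auto simp: W_def disjnt_def)
      then show "\<exists>W. openin X W \<and> x \<in> W \<and> (\<forall>F\<in>{S, T}. \<forall>G\<in>{S, T}. F \<inter> W \<noteq> {} \<and> G \<inter> W \<noteq> {} \<longrightarrow> F = G)"
        by (intro exI[of _ W]) (auto simp: W_def split: if_splits)
    qed
    then obtain U where "\<forall>F\<in>{S, T}. openin X (U F) \<and> F \<subseteq> U F" "disjoint_family_on U {S, T}"
      using assms ST unfolding collectionwise_normal_space_def by (metis insertE singletonD)
    then show ?thesis
      using False by (intro exI[of _ "U S"] exI[of _ "U T"]) (auto simp: disjoint_family_on_def disjnt_def)
  qed
qed

section \<open>Semi-proximal products\<close>

text \<open>The uniformity with the open equivalence relations as a base: every partition into clopen pieces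
  is a possible move of player 1.\<close>

definition clopen_uniformity :: "'a::topological_space set \<Rightarrow> ('a \<times> 'a) set set" where
  "clopen_uniformity X = {U. U \<subseteq> X \<times> X \<and> (\<exists>E. open_equiv X E \<and> E \<subseteq> U)}"

lemma open_equiv_Int:
  assumes "open_equiv X D" "open_equiv X E"
  shows "open_equiv X (D \<inter> E)"
  unfolding open_equiv_def
proof (intro conjI ballI)
  have "equiv X D" "equiv X E"
    using assms by (simp_all add: open_equiv_def)
  then show "equiv X (D \<inter> E)"
    unfolding equiv_def refl_on_def sym_def trans_def by blast
  fix x assume "x \<in> X"
  then have "\<forall>\<^sub>F y in nhds x. y \<in> X \<longrightarrow> (x, y) \<in> D" "\<forall>\<^sub>F y in nhds x. y \<in> X \<longrightarrow> (x, y) \<in> E"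
    using assms by (simp_all add: open_equiv_def)
  then show "\<forall>\<^sub>F y in nhds x. y \<in> X \<longrightarrow> (x, y) \<in> D \<inter> E"
    by eventually_elim simp
qed

lemma open_equiv_in_clopen_uniformity:
  assumes "open_equiv X E"
  shows "E \<in> clopen_uniformity X"
  using assms by (auto simp: clopen_uniformity_def open_equiv_def equiv_def)

lemma is_uniformity_clopen: "is_uniformity_on X (clopen_uniformity X)"
  unfolding is_uniformity_on_def
proof (intro conjI ballI allI impI)
  have "open_equiv X (kernel_on X (\<lambda>_. ()))"
    by (intro open_equiv_kernel_on locally_constant_on_const)
  then show "X \<times> X \<in> clopen_uniformity X"
    by (auto simp: clopen_uniformity_def kernel_on_def)
next
  fix U assume U: "U \<in> clopen_uniformity X"
  then obtain E where E: "open_equiv X E" "E \<subseteq> U" "U \<subseteq> X \<times> X"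
    by (auto simp: clopen_uniformity_def)
  then have eq: "E \<subseteq> X \<times> X" "refl_on X E" "sym E" "trans E"
    by (auto simp: open_equiv_def equiv_def)
  show "Id_on X \<subseteq> U"
    using eq(2) E(2) by (auto simp: refl_on_def)
  show "U \<subseteq> X \<times> X"
    by fact
  show "U\<inverse> \<in> clopen_uniformity X"
    unfolding clopen_uniformity_def using E eq(3)
    by (auto intro!: exI[of _ E] dest: symD)
  show "\<exists>V\<in>clopen_uniformity X. V O V \<subseteq> U"
    using open_equiv_in_clopen_uniformity[OF E(1)] trans_O_subset[OF eq(4)] E(2)
    by (intro bexI[of _ E]) auto
  show "V \<in> clopen_uniformity X" if "U \<subseteq> V \<and> V \<subseteq> X \<times> X" for V
    unfolding clopen_uniformity_def using E that by blast
  show "U \<inter> V \<in> clopen_uniformity X" if "V \<in> clopen_uniformity X" for V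
  proof -
    obtain D where "open_equiv X D" "D \<subseteq> V"
      using \<open>V \<in> clopen_uniformity X\<close> by (auto simp: clopen_uniformity_def)
    then have "open_equiv X (E \<inter> D)" "E \<inter> D \<subseteq> U \<inter> V"
      using E open_equiv_Int by blast+
    then show ?thesis
      unfolding clopen_uniformity_def using E(3) by blast
  qed
qed

lemma uniform_topology_clopen:
  fixes X :: "(omega1 \<times> omega1) set"
  shows "uniform_topology X (clopen_uniformity X) = top_of_set X"
proof (rule topology_eq[THEN iffD2], rule allI)
  fix W
  have "openin (top_of_set X) W" if "W \<subseteq> X" and W: "\<forall>x\<in>W. \<exists>U\<in>clopen_uniformity X. U `` {x} \<subseteq> W"
  proof (subst openin_subopen, intro ballI)
    fix x assume "x \<in> W"
    then obtain E where E: "open_equiv X E" "E `` {x} \<subseteq> W"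
      using W unfolding clopen_uniformity_def by blast
    have "x \<in> E `` {x}"
      using E(1) \<open>x \<in> W\<close> \<open>W \<subseteq> X\<close> equiv_class_self[of X E x] by (auto simp: open_equiv_def)
    then show "\<exists>T. openin (top_of_set X) T \<and> x \<in> T \<and> T \<subseteq> W"
      using openin_open_equiv_class[OF E(1)] E(2) by blast
  qed
  moreover have "\<exists>U\<in>clopen_uniformity X. U `` {x} \<subseteq> W" if W: "openin (top_of_set X) W" "x \<in> W" for x
  proof -
    obtain T where T: "open T" "W = X \<inter> T"
      using W(1) by (auto simp: openin_open)
    then obtain V where V: "open V" "closed V" "x \<in> V" "V \<subseteq> T"
      using open_prod_clopen[of T x] W(2) by auto
    have "kernel_on X (\<lambda>y. y \<in> V) \<in> clopen_uniformity X"
      using V(1,2)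
      by (intro open_equiv_in_clopen_uniformity open_equiv_kernel_on locally_constant_on_mem_clopen)
    moreover have "kernel_on X (\<lambda>y. y \<in> V) `` {x} \<subseteq> W"
      using V(3,4) T(2) unfolding kernel_on_def by blast
    ultimately show ?thesis
      by blast
  qed
  moreover have "W \<subseteq> X" if "openin (top_of_set X) W"
    using that openin_subset by fastforce
  ultimately show "openin (uniform_topology X (clopen_uniformity X)) W = openin (top_of_set X) W"
    unfolding openin_uniform_topology[OF is_uniformity_clopen] by blast
qed

text \<open>The list of the first \<open>n\<close> replies of a player 2 with strategy \<open>\<sigma>\<close> to the moves
  \<open>U\<close>; \<open>reply \<sigma> U n\<close> is the reply to \<open>U n\<close>, which depends only on
  \<open>U 0, \<dots>, U n\<close>.\<close>

primrec replies :: "('u list \<Rightarrow> 'a list \<Rightarrow> 'a) \<Rightarrow> (nat \<Rightarrow> 'u) \<Rightarrow> nat \<Rightarrow> 'a list" where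
  "replies \<sigma> U 0 = []"
| "replies \<sigma> U (Suc n) = replies \<sigma> U n @ [\<sigma> (map U [0..<Suc n]) (replies \<sigma> U n)]"

definition reply :: "('u list \<Rightarrow> 'a list \<Rightarrow> 'a) \<Rightarrow> (nat \<Rightarrow> 'u) \<Rightarrow> nat \<Rightarrow> 'a" where
  "reply \<sigma> U n = \<sigma> (map U [0..<Suc n]) (replies \<sigma> U n)"

lemma replies_eq_map: "replies \<sigma> U n = map (reply \<sigma> U) [0..<n]"
  by (induction n) (simp_all add: reply_def)

lemma reply_rec: "reply \<sigma> U n = \<sigma> (map U [0..<Suc n]) (map (reply \<sigma> U) [0..<n])"
  unfolding replies_eq_map[symmetric] by (rule reply_def)

lemma reply_cong:
  assumes "\<And>k. k \<le> n \<Longrightarrow> U k = V k"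
  shows "reply \<sigma> U n = reply \<sigma> V n"
  using assms
proof (induction n rule: less_induct)
  case (less n)
  have "map U [0..<Suc n] = map V [0..<Suc n]"
    using less.prems by (intro map_cong) auto
  moreover have "map (reply \<sigma> U) [0..<n] = map (reply \<sigma> V) [0..<n]"
    using less.prems by (intro map_cong less.IH) auto
  ultimately show ?case
    by (simp only: reply_rec)
qed

lemma locally_constant_on_finite_le:
  "locally_constant_on X (\<lambda>x :: omega1. {q \<in> set qs. x \<le> q})"
  unfolding locally_constant_on_def
proof
  fix x assume "x \<in> X"
  have "\<forall>\<^sub>F y in nhds x. \<forall>q\<in>set qs. y \<in> X \<longrightarrow> (y \<le> q) = (x \<le> q)"
    using locally_constant_on_le[of X] \<open>x \<in> X\<close>
    by (intro eventually_ball_finite) (auto simp: locally_constant_on_def)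
  then show "\<forall>\<^sub>F y in nhds x. y \<in> X \<longrightarrow> {q \<in> set qs. y \<le> q} = {q \<in> set qs. x \<le> q}"
    by eventually_elim blast
qed

text \<open>A locally constant label that confines each point to a bounded piece if \<open>A\<close> is not
  stationary; a stationary set is not cut at all.\<close>

lemma bounded_label:
  obtains l :: "omega1 \<Rightarrow> omega1 set" and n where
    "locally_constant_on A l" "\<And>a. a < n a" "\<And>a z. \<not> stationary A \<Longrightarrow> l z = l a \<Longrightarrow> z < n a"
proof (cases "stationary A")
  case True
  obtain n :: "omega1 \<Rightarrow> omega1" where "\<And>a. a < n a"
    using ex_gt_omega1 by metis
  then show thesis
    using that[OF locally_constant_on_const[of A "{}"], of n] True by blast
next
  case False
  obtain l :: "omega1 \<Rightarrow> omega1 set" and n where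
    "locally_constant_on A l" "\<And>a z. l z = l a \<Longrightarrow> z < n a"
    using nonstationary_label[OF False] by metis
  then show thesis
    using that[of l n] by blast
qed

text \<open>If the points \<open>y n\<close> below \<open>d\<close> end up on the same side as \<open>w\<close> of every cut below
  \<open>d\<close>, they converge to \<open>w\<close> or to \<open>d\<close>, whichever is smaller.\<close>

lemma convergent_of_cuts:
  fixes y :: "nat \<Rightarrow> omega1"
  assumes q: "range q = {..<d}"
    and cut: "\<And>n k. k < n \<Longrightarrow> y n \<le> q k \<longleftrightarrow> w \<le> q k"
    and y: "\<And>n. y n < d" and "w \<in> A" and d: "d \<le> w \<Longrightarrow> d \<in> A"
  shows "\<exists>l\<in>A. y \<longlonglongrightarrow> l"
proof -
  define l where "l = min w d"
  have "l \<in> A"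
    using \<open>w \<in> A\<close> d by (auto simp: l_def min_def)
  moreover have "y \<longlonglongrightarrow> l"
  proof (rule order_tendstoI)
    fix a assume "a < l"
    then have a: "a < d" "\<not> w \<le> a"
      by (auto simp: l_def)
    then have "a \<in> range q"
      by (simp add: q)
    then obtain k where k: "a = q k"
      by auto
    have "a < y n" if "k < n" for n
      using cut[OF that] a(2) k by (metis not_le)
    then show "\<forall>\<^sub>F n in sequentially. a < y n"
      by (rule eventually_mono[OF eventually_gt_at_top])
  next
    fix a assume a: "l < a"
    show "\<forall>\<^sub>F n in sequentially. y n < a"
    proof (cases "w < d")
      case True
      then have "w \<in> range q"
        by (simp add: q)
      then obtain k where k: "w = q k"
        by auto
      have "w < a"
        using a True by (simp add: l_def min.absorb3)
      then have "y n < a" if "k < n" for n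
        using cut[OF that] k by (simp add: order_le_less_trans)
      then show ?thesis
        by (rule eventually_mono[OF eventually_gt_at_top])
    next
      case False
      then have "d < a"
        using a by (simp add: l_def min.absorb2)
      then have "y n < a" for n
        using y[of n] by (rule less_trans[rotated])
      then show ?thesis
        by simp
    qed
  qed
  ultimately show ?thesis ..
qed

lemma closed_under_replies:
  fixes h :: "omega1 list \<Rightarrow> omega1"
  assumes "stationary S"
  obtains d where "d \<in> S" "\<exists>y. y < d" "\<And>qs. set qs \<subseteq> {..<d} \<Longrightarrow> h qs < d"
proof -
  have "countable (lists {..x})" for x :: omega1
    using countable_atMost_omega1 by (rule countable_lists)
  then obtain H where H: "\<And>x qs. qs \<in> lists {..x} \<Longrightarrow> h qs < H x"
    using strict_bound_function[of "\<lambda>x. lists {..x}" h] by blast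
  obtain d where d: "d \<in> S" "d \<in> {d. \<forall>x<d. H x < d}" "undefined < d"
    using stationary_meets_club[OF assms club_closure_points] .
  have "h qs < d" if qs: "set qs \<subseteq> {..<d}" for qs
  proof -
    \<comment> \<open>\<open>undefined < d\<close> serves as the maximum of the empty list.\<close>
    define m where "m = Max (insert undefined (set qs))"
    have "m \<in> insert undefined (set qs)"
      unfolding m_def by (rule Max_in) auto
    then have "m < d"
      using qs d(3) by auto
    have "x \<le> m" if "x \<in> set qs" for x
      unfolding m_def using that by (intro Max_ge) auto
    then have "h qs < H m"
      by (intro H) auto
    also have "\<dots> < d"
      using d(2) \<open>m < d\<close> by simp
    finally show ?thesis .
  qed
  then show thesis
    using that d by blast
qed

lemma semi_proximal_times:
  fixes A B :: "omega1 set"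
  assumes AB: "\<not> stationary A \<or> \<not> stationary B \<or> stationary (A \<inter> B)"
  shows "semi_proximal_space (top_of_set (A \<times> B))"
proof -
  define X where "X = A \<times> B"
  have "\<not> winning_strategy2 X (clopen_uniformity X) \<sigma>" for \<sigma>
  proof
    assume win: "winning_strategy2 X (clopen_uniformity X) \<sigma>"
    obtain l :: "omega1 \<Rightarrow> omega1 set" and n where l: "locally_constant_on A l" "\<And>a. a < n a"
      "\<And>a z. \<not> stationary A \<Longrightarrow> l z = l a \<Longrightarrow> z < n a"
      using bounded_label[of A] by metis
    obtain l' :: "omega1 \<Rightarrow> omega1 set" and n' where l': "locally_constant_on B l'" "\<And>a. a < n' a"
      "\<And>a z. \<not> stationary B \<Longrightarrow> l' z = l' a \<Longrightarrow> z < n' a"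
      using bounded_label[of B] by metis
    define L where "L qs z = ((l (fst z), {q \<in> set qs. fst z \<le> q}), (l' (snd z), {q \<in> set qs. snd z \<le> q}))"
      for qs z
    define E where "E qs = kernel_on X (L qs)" for qs
    have "locally_constant_on X (L qs)" for qs
      unfolding L_def[abs_def] X_def
      by (intro locally_constant_on_Pair locally_constant_on_fst[OF l(1)]
          locally_constant_on_snd[OF l'(1)] locally_constant_on_fst[OF locally_constant_on_finite_le]
          locally_constant_on_snd[OF locally_constant_on_finite_le])
    then have E: "open_equiv X (E qs)" for qs
      unfolding E_def by (rule open_equiv_kernel_on)
    \<comment> \<open>The reply after cuts at the elements of \<open>qs\<close>, played one at a time. The
        pieces of a nonstationary factor are cut already by the first move
        \<open>E []\<close>.\<close>
    define resp where "resp qs = reply \<sigma> (\<lambda>k. E (take k qs)) (length qs)" for qs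
    \<comment> \<open>\<open>S\<close> is stationary by (c).\<close>
    define S where "S = (if stationary A then A else UNIV) \<inter> (if stationary B then B else UNIV)"
    have "stationary S"
      using AB stationary_Int_club club_UNIV by (auto simp: S_def stationary_def club_def)
    then obtain d where d: "d \<in> S" "\<exists>y. y < d"
      "\<And>qs. set qs \<subseteq> {..<d} \<Longrightarrow> max (n (fst (resp qs))) (n' (snd (resp qs))) < d"
      using closed_under_replies[of S "\<lambda>qs. max (n (fst (resp qs))) (n' (snd (resp qs)))"] by blast
    define q where "q = from_nat_into {..<d}"
    have q: "range q = {..<d}"
      unfolding q_def using d(2) by (intro range_from_nat_into countable_lessThan_omega1) auto
    define U where "U m = E (map q [0..<m])" for m
    define x where "x = reply \<sigma> U"
    have x_resp: "x m = resp (map q [0..<m])" for m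
      unfolding x_def resp_def length_map length_upt
      by (simp, rule reply_cong) (simp add: U_def take_map)
    have bound: "n (fst (x m)) < d" "n' (snd (x m)) < d" for m
    proof -
      have "set (map q [0..<m]) \<subseteq> {..<d}"
        unfolding q[symmetric] by auto
      from d(3)[OF this] show "n (fst (x m)) < d" "n' (snd (x m)) < d"
        by (simp_all add: x_resp)
    qed
    have "U (Suc m) \<subseteq> U m" for m
      by (auto simp: U_def E_def kernel_on_def L_def set_eq_iff)
    moreover have "U m \<in> clopen_uniformity X" "sym (U m)" for m
      using open_equiv_in_clopen_uniformity[OF E] E unfolding U_def
      by (simp_all add: open_equiv_def equiv_def)
    ultimately have "legal1 (clopen_uniformity X) U"
      by (simp add: legal1_def)
    moreover have "x m = \<sigma> (map U [0..<Suc m]) (map x [0..<m])" for m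
      unfolding x_def by (rule reply_rec)
    ultimately have "\<not> player1_wins X (clopen_uniformity X) U x"
      using win unfolding winning_strategy2_def by blast
    then obtain z where z: "\<And>m. (x m, z) \<in> U m"
      and div: "\<And>p. \<not> limitin (top_of_set X) x p sequentially"
      unfolding player1_wins_def uniform_topology_clopen by blast
    have x: "x m \<in> X" and lz: "l (fst z) = l (fst (x m))" "l' (snd z) = l' (snd (x m))" for m
      using z[of m] by (simp_all add: U_def E_def kernel_on_def L_def)
    have zX: "fst z \<in> A" "snd z \<in> B"
      using z[of 0] by (simp_all add: U_def E_def kernel_on_def X_def mem_Times_iff)
    have sets: "{p \<in> set (map q [0..<m]). fst (x m) \<le> p} = {p \<in> set (map q [0..<m]). fst z \<le> p}"
      "{p \<in> set (map q [0..<m]). snd (x m) \<le> p} = {p \<in> set (map q [0..<m]). snd z \<le> p}" for m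
      using z[of m] by (simp_all add: U_def E_def kernel_on_def L_def)
    have cut: "fst (x m) \<le> q k \<longleftrightarrow> fst z \<le> q k" "snd (x m) \<le> q k \<longleftrightarrow> snd z \<le> q k" if "k < m" for k m
    proof -
      have "q k \<in> set (map q [0..<m])"
        using that by simp
      then show "fst (x m) \<le> q k \<longleftrightarrow> fst z \<le> q k" "snd (x m) \<le> q k \<longleftrightarrow> snd z \<le> q k"
        using sets[of m] by blast+
    qed
    \<comment> \<open>If \<open>A\<close> is not stationary, \<open>fst z < d\<close>, since
        \<open>fst z\<close> lies in the same piece as \<open>fst (x 0)\<close>.\<close>
    have "\<exists>p\<in>A. (\<lambda>m. fst (x m)) \<longlonglongrightarrow> p"
    proof (rule convergent_of_cuts[OF q cut(1) _ zX(1)])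
      show "fst (x m) < d" for m
        using l(2) bound(1) by (rule less_trans)
      assume "d \<le> fst z"
      then have "\<not> fst z < n (fst (x 0))"
        using bound(1)[of 0] by (meson leD less_trans order_le_less_trans)
      then have "stationary A"
        using l(3) lz(1) by blast
      then show "d \<in> A"
        using d(1) by (simp add: S_def)
    qed
    moreover have "\<exists>p\<in>B. (\<lambda>m. snd (x m)) \<longlonglongrightarrow> p"
    proof (rule convergent_of_cuts[OF q cut(2) _ zX(2)])
      show "snd (x m) < d" for m
        using l'(2) bound(2) by (rule less_trans)
      assume "d \<le> snd z"
      then have "\<not> snd z < n' (snd (x 0))"
        using bound(2)[of 0] by (meson leD less_trans order_le_less_trans)
      then have "stationary B"
        using l'(3) lz(2) by blast
      then show "d \<in> B"
        using d(1) by (simp add: S_def)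
    qed
    ultimately obtain a b where ab: "a \<in> A" "b \<in> B"
      "(\<lambda>m. fst (x m)) \<longlonglongrightarrow> a" "(\<lambda>m. snd (x m)) \<longlonglongrightarrow> b"
      by blast
    have "x \<longlonglongrightarrow> (a, b)"
      using tendsto_Pair[OF ab(3,4)] by simp
    then have "limitin (top_of_set X) x (a, b) sequentially"
      using ab(1,2) x by (simp add: limitin_subtopology X_def)
    then show False
      using div by blast
  qed
  then have "semi_proximal_uniform X (clopen_uniformity X)"
    by (simp add: semi_proximal_uniform_def)
  moreover have "compatible_uniformity (top_of_set X) (clopen_uniformity X)"
    by (simp add: compatible_uniformity_def is_uniformity_clopen uniform_topology_clopen)
  ultimately show ?thesis
    unfolding semi_proximal_space_def X_def[symmetric] by auto
qed

section \<open>Stationary factors with nonstationary intersection\<close>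

lemma is_uniformity_onD:
  assumes "is_uniformity_on X \<UU>" "U \<in> \<UU>"
  shows "Id_on X \<subseteq> U" "U \<subseteq> X \<times> X" "U\<inverse> \<in> \<UU>" "\<exists>V\<in>\<UU>. V O V \<subseteq> U"
    and "V \<in> \<UU> \<Longrightarrow> U \<inter> V \<in> \<UU>"
proof -
  have "\<forall>U\<in>\<UU>. Id_on X \<subseteq> U \<and> U \<subseteq> X \<times> X" and Int: "\<forall>U\<in>\<UU>. \<forall>V\<in>\<UU>. U \<inter> V \<in> \<UU>"
    and "\<forall>U\<in>\<UU>. U\<inverse> \<in> \<UU>" "\<forall>U\<in>\<UU>. \<exists>V\<in>\<UU>. V O V \<subseteq> U"
    using assms(1) unfolding is_uniformity_on_def by - (elim conjE, assumption)+
  then show "Id_on X \<subseteq> U" "U \<subseteq> X \<times> X" "U\<inverse> \<in> \<UU>" "\<exists>V\<in>\<UU>. V O V \<subseteq> U"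
    using assms(2) by simp_all
  show "U \<inter> V \<in> \<UU>" if "V \<in> \<UU>"
    using Int assms(2) that by simp
qed

lemma uniform_nhds:
  fixes X :: "'a::topological_space set"
  assumes comp: "compatible_uniformity (top_of_set X) \<UU>" and "U \<in> \<UU>" "x \<in> X"
  obtains W where "open W" "x \<in> W" "\<And>y. y \<in> W \<inter> X \<Longrightarrow> (x, y) \<in> U"
proof -
  have unif: "is_uniformity_on X \<UU>" and top: "uniform_topology X \<UU> = top_of_set X"
    using comp by (simp_all add: compatible_uniformity_def)
  have refl: "(y, y) \<in> V" if "V \<in> \<UU>" "y \<in> X" for y V
    using is_uniformity_onD(1)[OF unif that(1)] that(2) by auto
  \<comment> \<open>The interior of \<open>U `` {x}\<close>.\<close>
  define N where "N = {y \<in> X. \<exists>V\<in>\<UU>. V `` {y} \<subseteq> U `` {x}}"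
  have "\<exists>V\<in>\<UU>. V `` {y} \<subseteq> N" if y: "y \<in> N" for y
  proof -
    obtain V where V: "V \<in> \<UU>" "V `` {y} \<subseteq> U `` {x}"
      using y by (auto simp: N_def)
    obtain V' where V': "V' \<in> \<UU>" "V' O V' \<subseteq> V"
      using is_uniformity_onD(4)[OF unif V(1)] by auto
    have "V' \<subseteq> X \<times> X"
      using unif V'(1) by (rule is_uniformity_onD(2))
    have "z \<in> N" if "(y, z) \<in> V'" for z
    proof -
      have "V' `` {z} \<subseteq> V `` {y}"
        using V'(2) that by blast
      then have "V' `` {z} \<subseteq> U `` {x}"
        using V(2) by (rule subset_trans)
      moreover have "z \<in> X"
        using that \<open>V' \<subseteq> X \<times> X\<close> by blast
      ultimately show ?thesis
        using V'(1) unfolding N_def by blast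
    qed
    then show ?thesis
      using V'(1) by blast
  qed
  then have "openin (uniform_topology X \<UU>) N"
    unfolding openin_uniform_topology[OF unif] by (simp add: N_def)
  then obtain W where W: "open W" "N = X \<inter> W"
    unfolding top openin_open by blast
  have "x \<in> N"
    using \<open>U \<in> \<UU>\<close> \<open>x \<in> X\<close> by (auto simp: N_def)
  moreover have "(x, y) \<in> U" if y: "y \<in> N" for y
  proof -
    obtain V where "y \<in> X" "V \<in> \<UU>" "V `` {y} \<subseteq> U `` {x}"
      using y by (auto simp: N_def)
    then show ?thesis
      using refl[of V y] by blast
  qed
  ultimately show thesis
    using that[OF W(1)] W(2) by (simp add: Int_commute)
qed

lemma open_slices:
  assumes "open W" "(a, b) \<in> W"
  obtains S T where "open S" "a \<in> S" "open T" "b \<in> T"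
    "\<And>x. x \<in> S \<Longrightarrow> (x, b) \<in> W" "\<And>y. y \<in> T \<Longrightarrow> (a, y) \<in> W"
proof -
  obtain S T where ST: "open S" "open T" "(a, b) \<in> S \<times> T" "S \<times> T \<subseteq> W"
    using open_prod_elim[OF assms] .
  show thesis
  proof (rule that[OF ST(1) _ ST(2)])
    show "a \<in> S" "b \<in> T"
      using ST(3) by simp_all
    then show "(x, b) \<in> W" if "x \<in> S" for x
      using that ST(4) by (intro subsetD[OF ST(4)]) simp
    show "(a, y) \<in> W" if "y \<in> T" for y
      using that \<open>a \<in> S\<close> by (intro subsetD[OF ST(4)]) simp
  qed
qed

text \<open>For each \<open>a\<close>, pressing down in \<open>B\<close> gives \<open>g a\<close> above which the vertical line
  over \<open>a\<close> is small. Two such lines over \<open>a, a' > c\<close> are connected along a horizontal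
  segment at height \<open>f s\<close>, where \<open>s\<close> lies above \<open>a\<close> and \<open>a'\<close> and
  \<open>f s\<close> above \<open>g a\<close> and \<open>g a'\<close>; \<open>c\<close> comes from pressing down in \<open>A\<close>.
  This makes a chain of six steps.\<close>

lemma small_tail:
  fixes A B :: "omega1 set"
  assumes A: "stationary A" and B: "stationary B"
    and comp: "compatible_uniformity (top_of_set (A \<times> B)) \<UU>" and U: "U \<in> \<UU>"
  shows "\<exists>c g. \<forall>a\<in>A. \<forall>b\<in>B. \<forall>a'\<in>A. \<forall>b'\<in>B. c < a \<and> g a < b \<and> c < a' \<and> g a' < b' \<longrightarrow>
           ((a, b), (a', b')) \<in> U"
proof -
  have unif: "is_uniformity_on (A \<times> B) \<UU>"
    using comp by (simp add: compatible_uniformity_def)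
  note half = is_uniformity_onD(4)[OF unif]
  obtain V1 where V1: "V1 \<in> \<UU>" "V1 O V1 \<subseteq> U"
    using half[OF U] by blast
  obtain V2 where V2: "V2 \<in> \<UU>" "V2 O V2 \<subseteq> V1"
    using half[OF V1(1)] by blast
  obtain V3 where V3: "V3 \<in> \<UU>" "V3 O V3 \<subseteq> V2"
    using half[OF V2(1)] by blast
  define W where "W = V3 \<inter> V3\<inverse>"
  have W: "W \<in> \<UU>"
    unfolding W_def using is_uniformity_onD(3,5)[OF unif V3(1)] by simp
  have sym: "(y, x) \<in> W" if "(x, y) \<in> W" for x y
    using that by (auto simp: W_def)
  have "Id_on (A \<times> B) \<subseteq> V2" "W \<subseteq> (A \<times> B) \<times> (A \<times> B)"
    using is_uniformity_onD(1)[OF unif V2(1)] is_uniformity_onD(2)[OF unif W] by simp_all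
  have chain: "(p0, p6) \<in> U"
    if "(p0, p1) \<in> W" "(p1, p2) \<in> W" "(p2, p3) \<in> W" "(p3, p4) \<in> W" "(p4, p5) \<in> W" "(p5, p6) \<in> W"
    for p0 p1 p2 p3 p4 p5 p6
  proof -
    have *: "(p0, p2) \<in> V2" "(p2, p4) \<in> V2" "(p4, p6) \<in> V2"
      using that V3(2) unfolding W_def by blast+
    have "p6 \<in> A \<times> B"
      using that(6) \<open>W \<subseteq> (A \<times> B) \<times> (A \<times> B)\<close> by blast
    then have "(p6, p6) \<in> V2"
      using \<open>Id_on (A \<times> B) \<subseteq> V2\<close> by blast
    then have "(p0, p4) \<in> V1" "(p4, p6) \<in> V1"
      using * V2(2) by blast+
    then show ?thesis
      using V1(2) by blast
  qed
  have "\<forall>a\<in>A. \<exists>g. stationary {s \<in> B. \<forall>b\<in>{g<..s} \<inter> B. ((a, s), (a, b)) \<in> W}"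
  proof
    fix a assume a: "a \<in> A"
    have ex: "\<exists>T. open T \<and> s \<in> T \<and> (\<forall>b\<in>T \<inter> B. ((a, s), (a, b)) \<in> W)" if s: "s \<in> B" for s
    proof -
      have "(a, s) \<in> A \<times> B"
        using a s by simp
      then obtain N where N: "open N" "(a, s) \<in> N" "\<And>y. y \<in> N \<inter> A \<times> B \<Longrightarrow> ((a, s), y) \<in> W"
        using uniform_nhds[OF comp W] by metis
      obtain S T where "open T" "s \<in> T" "\<And>y. y \<in> T \<Longrightarrow> (a, y) \<in> N"
        using open_slices[OF N(1,2)] by metis
      then show ?thesis
        using N(3) a by (intro exI[of _ T]) simp
    qed
    show "\<exists>g. stationary {s \<in> B. \<forall>b\<in>{g<..s} \<inter> B. ((a, s), (a, b)) \<in> W}"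
      by (rule pressing_down[OF B ex]) blast+
  qed
  from bchoice[OF this] obtain g where
    "\<forall>a\<in>A. stationary {s \<in> B. \<forall>b\<in>{g a<..s} \<inter> B. ((a, s), (a, b)) \<in> W}" ..
  then have g: "stationary {s \<in> B. \<forall>b\<in>{g a<..s} \<inter> B. ((a, s), (a, b)) \<in> W}" if "a \<in> A" for a
    using that by (rule bspec)
  have vertical: "\<exists>s\<in>B. ((a, s), (a, b)) \<in> W \<and> ((a, s), (a, b')) \<in> W"
    if ab: "a \<in> A" "b \<in> B" "b' \<in> B" "g a < b" "g a < b'" for a b b'
  proof -
    obtain s where "s \<in> B" "\<forall>b\<in>{g a<..s} \<inter> B. ((a, s), (a, b)) \<in> W" "max b b' < s"
      using stationary_unbounded[OF g[OF ab(1)], of "max b b'"] by blast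
    then show ?thesis
      using ab by (intro bexI[of _ s]) auto
  qed
  \<comment> \<open>\<open>f a \<in> B\<close> has to lie above \<open>g i\<close> for all
      \<open>i \<le> a\<close>.\<close>
  obtain G where G: "\<And>a i. i \<in> {..a} \<Longrightarrow> g i < G a"
    using strict_bound_function[of "\<lambda>a. {..a}" g] countable_atMost_omega1 by blast
  have "\<exists>b\<in>B. G a < b" for a
    using stationary_unbounded[OF B] by metis
  then obtain f where f: "\<And>a. f a \<in> B" "\<And>a. G a < f a"
    by metis
  have ex: "\<exists>S. open S \<and> s \<in> S \<and> (\<forall>a\<in>S \<inter> A. ((s, f s), (a, f s)) \<in> W)" if s: "s \<in> A" for s
  proof -
    have "(s, f s) \<in> A \<times> B"
      using s f(1) by simp
    then obtain N where N: "open N" "(s, f s) \<in> N" "\<And>y. y \<in> N \<inter> A \<times> B \<Longrightarrow> ((s, f s), y) \<in> W"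
      using uniform_nhds[OF comp W] by metis
    obtain S T where "open S" "s \<in> S" "\<And>y. y \<in> S \<Longrightarrow> (y, f s) \<in> N"
      using open_slices[OF N(1,2)] by metis
    then show ?thesis
      using N(3) f(1) by (intro exI[of _ S]) simp
  qed
  obtain c where c: "stationary {s \<in> A. \<forall>a\<in>{c<..s} \<inter> A. ((s, f s), (a, f s)) \<in> W}"
    by (rule pressing_down[OF A ex]) blast+
  have "((a, b), (a', b')) \<in> U"
    if ab: "a \<in> A" "b \<in> B" "a' \<in> A" "b' \<in> B" "c < a" "g a < b" "c < a'" "g a' < b'" for a b a' b'
  proof -
    obtain s where s: "s \<in> A" "\<forall>a\<in>{c<..s} \<inter> A. ((s, f s), (a, f s)) \<in> W" "max a a' < s"
      using stationary_unbounded[OF c, of "max a a'"] by blast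
    have "a \<in> {c<..s} \<inter> A" "a' \<in> {c<..s} \<inter> A"
      using s(3) ab by auto
    then have "((s, f s), (a, f s)) \<in> W" "((s, f s), (a', f s)) \<in> W"
      by (simp_all only: s(2)[rule_format])
    moreover have "g a < f s" "g a' < f s"
      using s(3) by (auto intro!: less_trans[OF G f(2)])
    then obtain t t' where "((a, t), (a, b)) \<in> W" "((a, t), (a, f s)) \<in> W"
      "((a', t'), (a', f s)) \<in> W" "((a', t'), (a', b')) \<in> W"
      using vertical[of a b "f s"] vertical[of a' "f s" b'] ab f(1) by blast
    ultimately show ?thesis
      using chain sym by meson
  qed
  then show ?thesis
    by blast
qed

lemma not_semi_proximal_times:
  fixes A B :: "omega1 set"
  assumes A: "stationary A" and B: "stationary B" and AB: "\<not> stationary (A \<inter> B)"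
  shows "\<not> semi_proximal_space (top_of_set (A \<times> B))"
proof
  assume "semi_proximal_space (top_of_set (A \<times> B))"
  then obtain \<UU> where comp: "compatible_uniformity (top_of_set (A \<times> B)) \<UU>"
    and no_win: "\<And>\<sigma>. \<not> winning_strategy2 (A \<times> B) \<UU> \<sigma>"
    by (auto simp: semi_proximal_space_def semi_proximal_uniform_def)
  obtain C where C: "club C" "A \<inter> B \<inter> C = {}"
    using AB by (auto simp: stationary_def)
  have "\<forall>U\<in>\<UU>. \<exists>c g. \<forall>a\<in>A. \<forall>b\<in>B. \<forall>a'\<in>A. \<forall>b'\<in>B. c < a \<and> g a < b \<and> c < a' \<and> g a' < b' \<longrightarrow>
           ((a, b), (a', b')) \<in> U"
    using small_tail[OF A B comp] by blast
  then obtain c g where cg: "\<And>U a b a' b'. U \<in> \<UU> \<Longrightarrow> a \<in> A \<Longrightarrow> b \<in> B \<Longrightarrow> a' \<in> A \<Longrightarrow> b' \<in> B \<Longrightarrow>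
      c U < a \<Longrightarrow> g U a < b \<Longrightarrow> c U < a' \<Longrightarrow> g U a' < b' \<Longrightarrow> ((a, b), (a', b')) \<in> U"
    by metis
  define tail where "tail \<V> = {z \<in> A \<times> B. \<forall>U\<in>\<V>. c U < fst z \<and> g U (fst z) < snd z}" for \<V>
  have tail_small: "(x, y) \<in> U" if "U \<in> \<UU>" "x \<in> tail \<V>" "y \<in> tail \<W>" "U \<in> \<V>" "U \<in> \<W>" for x y U \<V> \<W>
  proof -
    have "x = (fst x, snd x)" "y = (fst y, snd y)"
      by simp_all
    then show ?thesis
      using that cg[of U "fst x" "snd x" "fst y" "snd y"] by (auto simp: tail_def)
  qed
  have tail_ex: "\<exists>z\<in>tail \<V>. p < fst z \<and> fst z < snd z" if "countable \<V>" for \<V> p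
  proof -
    obtain p' where p': "\<And>t. t \<in> insert p (c ` \<V>) \<Longrightarrow> t < p'"
      using countable_bounded_omega1[of "insert p (c ` \<V>)"] \<open>countable \<V>\<close> by auto
    obtain a where a: "a \<in> A" "p' < a"
      using stationary_unbounded[OF A] .
    obtain r where r: "\<And>t. t \<in> insert a ((\<lambda>U. g U a) ` \<V>) \<Longrightarrow> t < r"
      using countable_bounded_omega1[of "insert a ((\<lambda>U. g U a) ` \<V>)"] \<open>countable \<V>\<close> by auto
    obtain b where b: "b \<in> B" "r < b"
      using stationary_unbounded[OF B] .
    have "c U < a" "g U a < b" if "U \<in> \<V>" for U
      using that less_trans[OF p' a(2)] less_trans[OF r b(2)] by auto
    moreover have "p < a" "a < b"
      using less_trans[OF p' a(2)] less_trans[OF r b(2)] by auto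
    ultimately show ?thesis
      using a b by (intro bexI[of _ "(a, b)"]) (auto simp: tail_def)
  qed
  \<comment> \<open>A good reply lies in the tails of all entourages played, above the diagonal, and beyond
      all earlier points with an element of \<open>C\<close> in between.\<close>
  define good where "good Us xs z \<longleftrightarrow>
    z \<in> tail (set Us) \<and> fst z < snd z \<and> (\<forall>x\<in>set xs. \<exists>e\<in>C. snd x < e \<and> e < fst z)"
    for Us and xs :: "(omega1 \<times> omega1) list" and z
  have good_ex: "\<exists>z. good Us xs z" for Us xs
  proof -
    have "\<forall>e. \<exists>e'\<in>C. e < e'"
      using C(1) by (simp add: club_def)
    then obtain k where k: "\<And>e. k e \<in> C" "\<And>e. e < k e"
      by metis
    obtain p where p: "\<And>t. t \<in> (\<lambda>x. k (snd x)) ` set xs \<Longrightarrow> t < p"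
      using countable_bounded_omega1[of "(\<lambda>x. k (snd x)) ` set xs"] by (auto simp: countable_finite)
    obtain z where z: "z \<in> tail (set Us)" "p < fst z" "fst z < snd z"
      using tail_ex[of "set Us" p] by (auto simp: countable_finite)
    have "\<exists>e\<in>C. snd x < e \<and> e < fst z" if "x \<in> set xs" for x
      using k less_trans[OF p z(2)] that by (intro bexI[of _ "k (snd x)"]) auto
    then have "good Us xs z"
      using z by (simp add: good_def)
    then show ?thesis ..
  qed
  define \<sigma> where "\<sigma> Us xs = (SOME z. good Us xs z)" for Us xs
  have "good Us xs (\<sigma> Us xs)" for Us xs
    unfolding \<sigma>_def using good_ex by (rule someI_ex)
  then have \<sigma>: "\<sigma> Us xs \<in> tail (set Us)" "fst (\<sigma> Us xs) < snd (\<sigma> Us xs)"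
    "\<And>x. x \<in> set xs \<Longrightarrow> \<exists>e\<in>C. snd x < e \<and> e < fst (\<sigma> Us xs)" for Us xs
    by (simp_all add: good_def)
  have "winning_strategy2 (A \<times> B) \<UU> \<sigma>"
    unfolding winning_strategy2_def
  proof (intro allI impI, elim conjE)
    fix U x
    assume legal: "legal1 \<UU> U" and x: "\<forall>n. x n = \<sigma> (map U [0..<Suc n]) (map x [0..<n])"
    have U: "U n \<in> \<UU>" for n
      using legal by (simp add: legal1_def)
    have x_tail: "x n \<in> tail (U ` {..n})" for n
      using \<sigma>(1)[of "map U [0..<Suc n]" "map x [0..<n]"] x
      by (simp add: atLeast0LessThan lessThan_Suc_atMost del: upt_Suc)
    have up: "fst (x n) < snd (x n)" for n
      using \<sigma>(2) x by metis
    have club_between: "\<exists>e\<in>C. snd (x n) < e \<and> e < fst (x (Suc n))" for n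
      using \<sigma>(3)[of "x n" "map x [0..<Suc n]" "map U [0..<Suc (Suc n)]"] x by (metis atLeastLessThan_upt atLeastLessThan_iff image_eqI le0 lessI list.set_map)
    have in_X: "x n \<in> A \<times> B" for n
      using x_tail by (simp add: tail_def)
    have "x (Suc n) \<in> U n `` {x n}" for n
      using tail_small[OF U x_tail x_tail, of n n "Suc n"] by auto
    then have legal2: "legal2 (A \<times> B) U x"
      using in_X by (simp add: legal2_def)
    obtain z where "z \<in> tail (range U)"
      using tail_ex[of "range U" undefined] by auto
    then have "(x n, z) \<in> U n" for n
      using tail_small[OF U x_tail, of z "range U" n n] by auto
    then have "(\<Inter>n. U n `` {x n}) \<noteq> {}"
      by blast
    moreover have "\<not> limitin (uniform_topology (A \<times> B) \<UU>) x l sequentially" for l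
    proof
      assume "limitin (uniform_topology (A \<times> B) \<UU>) x l sequentially"
      then have l: "l \<in> A \<times> B" "x \<longlonglongrightarrow> l"
        using comp by (simp_all add: compatible_uniformity_def limitin_subtopology)
      have lim: "(\<lambda>n. fst (x n)) \<longlonglongrightarrow> fst l" "(\<lambda>n. snd (x n)) \<longlonglongrightarrow> snd l"
        using l(2) by (auto intro: tendsto_fst tendsto_snd)
      have lim': "(\<lambda>n. fst (x (Suc n))) \<longlonglongrightarrow> fst l"
        using lim(1) by (rule LIMSEQ_Suc)
      obtain e where e: "\<And>n. e n \<in> C" "\<And>n. snd (x n) < e n" "\<And>n. e n < fst (x (Suc n))"
        using club_between by metis
      have "fst l \<le> snd l"
        by (rule LIMSEQ_le[OF lim]) (use up in \<open>auto intro: less_imp_le\<close>)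
      moreover have "snd l \<le> fst l"
        by (rule LIMSEQ_le[OF lim(2) lim']) (use e less_trans in \<open>blast intro: less_imp_le\<close>)
      ultimately have eq: "snd l = fst l"
        by simp
      have "\<forall>\<^sub>F n in sequentially. snd (x n) \<le> e n" "\<forall>\<^sub>F n in sequentially. e n \<le> fst (x (Suc n))"
        by (rule always_eventually, rule allI, rule less_imp_le, rule e)+
      then have "e \<longlonglongrightarrow> fst l"
        using lim(2)[unfolded eq] lim' by (rule tendsto_sandwich)
      then have "fst l \<in> C"
        using closed_sequentially[of C e] C(1) e(1) by (auto simp: club_def)
      then show False
        using C(2) l(1) eq by (auto simp: mem_Times_iff)
    qed
    ultimately show "legal2 (A \<times> B) U x \<and> \<not> player1_wins (A \<times> B) \<UU> U x"
      using legal2 by (simp add: player1_wins_def)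
  qed
  then show False
    using no_win by blast
qed

lemma not_normal_times:
  fixes A B :: "omega1 set"
  assumes A: "stationary A" and B: "stationary B" and AB: "\<not> stationary (A \<inter> B)"
  shows "\<not> normal_space (top_of_set (A \<times> B))"
proof
  assume normal: "normal_space (top_of_set (A \<times> B))"
  obtain C where C: "club C" "A \<inter> B \<inter> C = {}"
    using AB by (auto simp: stationary_def)
  define f where "f a = (LEAST b. b \<in> B \<and> a < b)" for a
  have "\<exists>b. b \<in> B \<and> a < b" for a
    using stationary_unbounded[OF B] by metis
  then have f: "f a \<in> B" "a < f a" for a
    unfolding f_def by (metis (mono_tags, lifting) LeastI_ex)+
  have f_le: "f a \<le> b" if "b \<in> B" "a < b" for a b
    unfolding f_def using that by (intro Least_le) simp
  define H where "H = {z \<in> A \<times> B. fst z \<in> C \<and> snd z = f (fst z)}"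
  define K where "K = {z \<in> A \<times> B. \<forall>p<snd z. \<exists>b\<in>B. p < b \<and> b < snd z}"
  have closedI: "closedin (top_of_set (A \<times> B)) F"
    if F: "F \<subseteq> A \<times> B"
      and nbhd: "\<And>a b. a \<in> A \<Longrightarrow> b \<in> B \<Longrightarrow> (a, b) \<notin> F \<Longrightarrow>
        \<exists>S T. open S \<and> open T \<and> a \<in> S \<and> b \<in> T \<and> F \<inter> S \<times> T = {}" for F
  proof -
    have "\<exists>T. openin (top_of_set (A \<times> B)) T \<and> z \<in> T \<and> T \<subseteq> A \<times> B - F" if z: "z \<in> A \<times> B - F" for z
    proof -
      obtain a b where ab: "z = (a, b)"
        by (rule prod.exhaust)
      obtain S T where "open S" "open T" "a \<in> S" "b \<in> T" "F \<inter> S \<times> T = {}"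
        using nbhd[of a b] z ab by auto
      then show ?thesis
        using z ab by (intro exI[of _ "(A \<times> B) \<inter> (S \<times> T)"] conjI openin_open_Int open_Times) auto
    qed
    then have "openin (top_of_set (A \<times> B)) (A \<times> B - F)"
      by (subst openin_subopen) blast
    then show ?thesis
      using F by (simp add: closedin_def)
  qed
  have "closedin (top_of_set (A \<times> B)) H"
  proof (rule closedI)
    show "H \<subseteq> A \<times> B"
      by (auto simp: H_def)
    fix a b assume ab: "a \<in> A" "b \<in> B" "(a, b) \<notin> H"
    \<comment> \<open>The graph could accumulate only at a diagonal point over \<open>C\<close>, and there is
        none in \<open>A \<times> B\<close>.\<close>
    consider "a \<notin> C" | "a \<in> C" "b < a" | "a \<in> C" "a < b"
      using C(2) ab by (metis IntI empty_iff linorder_neqE)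
    then show "\<exists>S T. open S \<and> open T \<and> a \<in> S \<and> b \<in> T \<and> H \<inter> S \<times> T = {}"
    proof cases
      case 1
      then show ?thesis
        using C(1) by (intro exI[of _ "- C"] exI[of _ UNIV]) (auto simp: club_def H_def)
    next
      case 2
      have "z \<notin> {b<..} \<times> {..b}" if "z \<in> H" for z
        using that f(2)[of "fst z"] by (auto simp: H_def)
      then have "H \<inter> {b<..} \<times> {..b} = {}"
        by blast
      then show ?thesis
        using 2 open_atMost_omega1 by (intro exI[of _ "{b<..}"] exI[of _ "{..b}"]) simp
    next
      case 3
      have "f a < b"
        using f_le[of b a] ab 3 by (auto simp: H_def less_le)
      have f_mono: "f x \<le> f a" if "x \<le> a" for x
        using f(1) order_le_less_trans[OF that f(2)] by (rule f_le)
      have "z \<notin> {..a} \<times> {f a<..}" if "z \<in> H" for z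
        using that f_mono[of "fst z"] by (auto simp: H_def)
      then have "H \<inter> {..a} \<times> {f a<..} = {}"
        by blast
      then show ?thesis
        using \<open>f a < b\<close> open_atMost_omega1 by (intro exI[of _ "{..a}"] exI[of _ "{f a<..}"]) simp
    qed
  qed
  moreover have "closedin (top_of_set (A \<times> B)) K"
  proof (rule closedI)
    show "K \<subseteq> A \<times> B"
      by (auto simp: K_def)
    fix a b assume ab: "a \<in> A" "b \<in> B" "(a, b) \<notin> K"
    then obtain p where p: "p < b" "\<And>b'. b' \<in> B \<Longrightarrow> p < b' \<Longrightarrow> \<not> b' < b"
      by (auto simp: K_def)
    have "y = b" if "y \<in> B" "p < y" "y \<le> b" for y
      using p(2)[OF that(1,2)] that(3) by simp
    then have "z \<notin> UNIV \<times> {p<..b}" if "z \<in> K" for z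
      using that ab by (cases z) (auto simp: K_def)
    then have "K \<inter> UNIV \<times> {p<..b} = {}"
      by blast
    then show "\<exists>S T. open S \<and> open T \<and> a \<in> S \<and> b \<in> T \<and> K \<inter> S \<times> T = {}"
      using p(1) open_Ioc_omega1 by (intro exI[of _ UNIV] exI[of _ "{p<..b}"]) simp
  qed
  moreover have "disjnt H K"
  proof -
    have "z \<notin> K" if z: "z \<in> H" for z
    proof
      assume "z \<in> K"
      then obtain b where "b \<in> B" "fst z < b" "b < f (fst z)"
        using z f(2)[of "fst z"] by (auto simp: H_def K_def)
      then show False
        using f_le[of b "fst z"] by simp
    qed
    then show ?thesis
      by (auto simp: disjnt_def)
  qed
  ultimately obtain U V where UV: "openin (top_of_set (A \<times> B)) U" "openin (top_of_set (A \<times> B)) V"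
    "H \<subseteq> U" "K \<subseteq> V" "disjnt U V"
    using normal unfolding normal_space_def by meson
  obtain U' where U': "open U'" "U = (A \<times> B) \<inter> U'"
    using UV(1) by (auto simp: openin_open)
  obtain V' where V': "open V'" "V = (A \<times> B) \<inter> V'"
    using UV(2) by (auto simp: openin_open)
  have ex: "\<exists>S. open S \<and> s \<in> S \<and> (\<forall>a\<in>S \<inter> A. (a, f s) \<in> U)" if s: "s \<in> A \<inter> C" for s
  proof -
    have "(s, f s) \<in> U'"
      using s f(1) UV(3) U'(2) by (auto simp: H_def)
    then obtain S T where "open S" "s \<in> S" "\<And>y. y \<in> S \<Longrightarrow> (y, f s) \<in> U'"
      using open_slices[OF U'(1)] by metis
    then show ?thesis
      using f(1) U'(2) by (intro exI[of _ S]) simp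
  qed
  obtain c where c: "stationary {s \<in> A \<inter> C. \<forall>a\<in>{c<..s} \<inter> A. (a, f s) \<in> U}"
    by (rule pressing_down[OF stationary_Int_club[OF A C(1)] ex]) blast+
  have "\<exists>s. \<xi> < s \<and> (\<forall>a\<in>{c<..s} \<inter> A. (a, f s) \<in> U)" for \<xi>
    using stationary_unbounded[OF c, of \<xi>] by blast
  then obtain h where h: "\<And>\<xi>. \<xi> < h \<xi>" "\<And>\<xi> a. a \<in> A \<Longrightarrow> c < a \<Longrightarrow> a \<le> h \<xi> \<Longrightarrow> (a, f (h \<xi>)) \<in> U"
    by (metis IntI greaterThanAtMost_iff)
  obtain a where a: "a \<in> A" "c < a"
    using stationary_unbounded[OF A] .
  \<comment> \<open>\<open>b \<in> B\<close> is a limit of values \<open>f (h \<xi>)\<close> such that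
      \<open>(a, f (h \<xi>)) \<in> U\<close>.\<close>
  obtain b where b: "b \<in> B" "b \<in> {d. \<forall>\<xi><d. f (h \<xi>) < d}" "a < b"
    using stationary_meets_club[OF B club_closure_points] .
  have "(a, b) \<in> K"
    unfolding K_def
  proof (clarsimp simp: a b, intro bexI conjI)
    fix p assume "p < b"
    show "p < f (h p)"
      using h(1) f(2) by (rule less_trans)
    show "f (h p) < b"
      using b(2) \<open>p < b\<close> by simp
  qed (rule f(1))
  then have "(a, b) \<in> V'"
    using UV(4) V'(2) by blast
  then obtain S T where T: "open T" "b \<in> T" "\<And>y. y \<in> T \<Longrightarrow> (a, y) \<in> V'"
    using open_slices[OF V'(1)] by metis
  obtain p where p: "p < b" "{p<..b} \<subseteq> T"
    using open_left_omega1[OF T(1,2) b(3)] .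
  define \<xi> where "\<xi> = max a p"
  have "\<xi> < b"
    using b(3) p(1) by (simp add: \<xi>_def)
  then have "f (h \<xi>) < b"
    using b(2) by simp
  moreover have "\<xi> < f (h \<xi>)"
    using h(1) f(2) by (rule less_trans)
  ultimately have "f (h \<xi>) \<in> T"
    using p(2) by (auto simp: \<xi>_def)
  then have "(a, f (h \<xi>)) \<in> V"
    using T(3) a(1) f(1) V'(2) by simp
  moreover have "(a, f (h \<xi>)) \<in> U"
    using a h(1)[of \<xi>] by (intro h(2)) (simp_all add: \<xi>_def less_imp_le)
  ultimately show False
    using UV(5) by (auto simp: disjnt_def)
qed

section \<open>The four conditions are equivalent\<close>

theorem corollary6p6:
  fixes A B :: "omega1 set"
  shows "(collectionwise_normal_space (prod_topology (top_of_set A) (top_of_set B)) \<longleftrightarrow>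
            normal_space (prod_topology (top_of_set A) (top_of_set B))) \<and>
         (normal_space (prod_topology (top_of_set A) (top_of_set B)) \<longleftrightarrow>
            \<not> stationary A \<or> \<not> stationary B \<or> stationary (A \<inter> B)) \<and>
         (\<not> stationary A \<or> \<not> stationary B \<or> stationary (A \<inter> B) \<longleftrightarrow>
            semi_proximal_space (prod_topology (top_of_set A) (top_of_set B)))"
  unfolding prod_topology_subtopology_eu
  using collectionwise_normal_times[of A B] collectionwise_normal_imp_normal
    not_normal_times[of A B] semi_proximal_times[of A B] not_semi_proximal_times[of A B]
  by blast

end
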